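(* The distribution of a unimodular network $[\mathbf G,\mathbf o]$ is uniquely determined by its restriction to the invariant sigma-field $I$ (equivalently, by the distribution of the non-rooted network $[\mathbf G]$ on $(\mathcal G,J)$). In other words, if $[\mathbf G_1,\mathbf o_1]$ and $[\mathbf G_2,\mathbf o_2]$ are unimodular networks that are strongly unrooted-equivalent, i.e. $\mathbb P([\mathbf G_1,\mathbf o_1]\in A)=\mathbb P([\mathbf G_2,\mathbf o_2]\in A)$ for all $A\in I$, then they are identically distributed.
   Context: Networks. Fix a complete separable metric space $\Xi$ (the mark space). A network is a connected, locally finite (every vertex has finite degree) multigraph $G$ with vertex set $V(G)$, together with a mark in $\Xi$ for each vertex $v$ and for each pair $(v,e)$ with $e$ an edge incident to $v$. A rooted network $(G,o)$ is a network with a distinguished vertex $o$; a doubly-rooted network $(G,o,v)$ has an ordered pair of distinguished vertices. Isomorphisms preserve marks and distinguished vertices. $\mathcal G$, $\mathcal G_*$ and $\mathcal G_{**}$ are the sets of isomorphism classes $[G]$, $[G,o]$ and $[G,o,v]$ of networks, rooted networks and doubly-rooted networks. $\mathcal G_*$ and $\mathcal G_{**}$ carry the Borel sigma-fields of the (Polish) local topologies: $[G_n,o_n]\to[G,o]$ iff for all $r\in\mathbb N$ and $\varepsilon>0$, for all large $n$ there is a graph isomorphism between the balls of radius $r$ about the roots that maps root to root and for which corresponding marks are at distance less than $\varepsilon$; for $\mathcal G_{**}$ one uses balls about the first root, with $r$ at least the distance of the two roots in the limit, and isomorphisms must also map second root to second root. $\pi:\mathcal G_*\to\mathcal G$ is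 $\pi[G,o]=[G]$, and $J=\{B\subseteq\mathcal G:\pi^{-1}(B)\text{ is measurable}\}$. A random rooted network $[\mathbf G,\mathbf o]$ is a random element of $\mathcal G_*$; $[\mathbf G]$ is its image under $\pi$, a random element of $(\mathcal G,J)$. Invariant sigma-field $I$: the family of measurable $A\subseteq\mathcal G_*$ such that $[G,o]\in A$ and $v\in V(G)$ imply $[G,v]\in A$. Unimodular: a random rooted network $[\mathbf G,\mathbf o]$ is unimodular (a "unimodular network") if for all measurable $g:\mathcal G_{**}\to\mathbb R^{\ge0}$, $\mathbb E\big[\sum_{v\in V(\mathbf G)}g[\mathbf G,\mathbf o,v]\big]=\mathbb E\big[\sum_{v\in V(\mathbf G)}g[\mathbf G,v,\mathbf o]\big]$ (both sides may be infinite). *)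

theory Defs
  imports "HOL-Probability.Probability"
begin

section \<open>Marked multigraphs and networks\<close>

text \<open>
  The endpoint set of an edge has one element (a loop) or two; parallel edges are allowed.
  \<open>emark G v e\<close> is the mark of the pair \<open>(v, e)\<close>. Values of \<open>ends\<close>, \<open>vmark\<close> and \<open>emark\<close> outside
  the vertices, edges and incident pairs of the graph carry no information.
\<close>

record ('v, 'e, 'm) marked_graph =
  verts :: "'v set"
  edges :: "'e set"
  ends :: "'e \<Rightarrow> 'v set"
  vmark :: "'v \<Rightarrow> 'm"
  emark :: "'v \<Rightarrow> 'e \<Rightarrow> 'm"

definition adj :: "('v, 'e, 'm) marked_graph \<Rightarrow> ('v \<times> 'v) set" where
  "adj G = {(u, v). \<exists>e\<in>edges G. ends G e = {u, v}}"

definition network :: "('v, 'e, 'm) marked_graph \<Rightarrow> bool" where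
  "network G \<longleftrightarrow>
     verts G \<noteq> {} \<and>
     (\<forall>e\<in>edges G. ends G e \<subseteq> verts G \<and> card (ends G e) \<in> {1, 2}) \<and>
     (\<forall>u\<in>verts G. \<forall>v\<in>verts G. (u, v) \<in> (adj G)\<^sup>*) \<and>
     (\<forall>v\<in>verts G. finite {e \<in> edges G. v \<in> ends G e})"

definition gdist :: "('v, 'e, 'm) marked_graph \<Rightarrow> 'v \<Rightarrow> 'v \<Rightarrow> nat" where
  "gdist G u v = (LEAST n. (u, v) \<in> adj G ^^ n)"

definition ball_verts :: "('v, 'e, 'm) marked_graph \<Rightarrow> 'v \<Rightarrow> nat \<Rightarrow> 'v set" where
  "ball_verts G p r = {v \<in> verts G. gdist G p v \<le> r}"

definition graph_ball :: "('v, 'e, 'm) marked_graph \<Rightarrow> 'v \<Rightarrow> nat \<Rightarrow> ('v, 'e, 'm) marked_graph" where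
  "graph_ball G p r =
     G\<lparr>verts := ball_verts G p r, edges := {e \<in> edges G. ends G e \<subseteq> ball_verts G p r}\<rparr>"

definition graph_iso ::
  "('v \<Rightarrow> 'w) \<Rightarrow> ('e \<Rightarrow> 'f) \<Rightarrow> ('v, 'e, 'm) marked_graph \<Rightarrow> ('w, 'f, 'm) marked_graph \<Rightarrow> bool" where
  "graph_iso f g G H \<longleftrightarrow>
     bij_betw f (verts G) (verts H) \<and> bij_betw g (edges G) (edges H) \<and>
     (\<forall>e\<in>edges G. ends H (g e) = f ` ends G e)"

definition network_iso ::
  "('v \<Rightarrow> 'w) \<Rightarrow> ('e \<Rightarrow> 'f) \<Rightarrow> ('v, 'e, 'm) marked_graph \<Rightarrow> ('w, 'f, 'm) marked_graph \<Rightarrow> bool" where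
  "network_iso f g G H \<longleftrightarrow>
     graph_iso f g G H \<and>
     (\<forall>v\<in>verts G. vmark H (f v) = vmark G v) \<and>
     (\<forall>e\<in>edges G. \<forall>v\<in>ends G e. emark H (f v) (g e) = emark G v e)"

definition marks_within ::
  "real \<Rightarrow> ('v \<Rightarrow> 'w) \<Rightarrow> ('e \<Rightarrow> 'f) \<Rightarrow>
   ('v, 'e, 'm::metric_space) marked_graph \<Rightarrow> ('w, 'f, 'm) marked_graph \<Rightarrow> bool" where
  "marks_within \<epsilon> f g G H \<longleftrightarrow>
     (\<forall>v\<in>verts G. dist (vmark G v) (vmark H (f v)) < \<epsilon>) \<and>
     (\<forall>e\<in>edges G. \<forall>v\<in>ends G e. dist (emark G v e) (emark H (f v) (g e)) < \<epsilon>)"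

definition ball_iso_within ::
  "nat \<Rightarrow> real \<Rightarrow> ('v \<Rightarrow> 'w) \<Rightarrow> ('e \<Rightarrow> 'f) \<Rightarrow>
   ('v, 'e, 'm::metric_space) marked_graph \<Rightarrow> 'v \<Rightarrow> ('w, 'f, 'm) marked_graph \<Rightarrow> 'w \<Rightarrow> bool" where
  "ball_iso_within r \<epsilon> f g G p H q \<longleftrightarrow>
     graph_iso f g (graph_ball G p r) (graph_ball H q r) \<and> f p = q \<and>
     marks_within \<epsilon> f g (graph_ball G p r) (graph_ball H q r)"


section \<open>Isomorphism classes\<close>

text \<open>
  A connected, locally finite multigraph has countably many vertices and edges, so each
  isomorphism class has a representative with vertices and edges in \<^typ>\<open>nat\<close>
  (lemma \<open>network_has_nat_copy\<close> below).
\<close>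

definition unrooted_iso ::
  "(nat, nat, 'm) marked_graph \<Rightarrow> (nat, nat, 'm) marked_graph \<Rightarrow> bool" where
  "unrooted_iso G H \<longleftrightarrow> network G \<and> network H \<and> (\<exists>f g. network_iso f g G H)"

definition rooted_iso ::
  "(nat, nat, 'm) marked_graph \<times> nat \<Rightarrow> (nat, nat, 'm) marked_graph \<times> nat \<Rightarrow> bool" where
  "rooted_iso = (\<lambda>(G, p) (H, q).
     network G \<and> network H \<and> p \<in> verts G \<and> q \<in> verts H \<and>
     (\<exists>f g. network_iso f g G H \<and> f p = q))"

definition birooted_iso ::
  "(nat, nat, 'm) marked_graph \<times> nat \<times> nat \<Rightarrow> (nat, nat, 'm) marked_graph \<times> nat \<times> nat \<Rightarrow> bool" where
  "birooted_iso = (\<lambda>(G, p, v) (H, q, w).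
     network G \<and> network H \<and> p \<in> verts G \<and> v \<in> verts G \<and> q \<in> verts H \<and> w \<in> verts H \<and>
     (\<exists>f g. network_iso f g G H \<and> f p = q \<and> f v = w))"

lemma network_iso_id: "network_iso id id G G"
  by (simp add: network_iso_def graph_iso_def)

lemma network_iso_comp:
  assumes "network_iso f g G H" "network_iso f' g' H K" "network G"
  shows "network_iso (f' \<circ> f) (g' \<circ> g) G K"
proof -
  have v: "f v \<in> verts H" if "v \<in> verts G" for v
    using assms(1) that by (auto simp: network_iso_def graph_iso_def bij_betw_def)
  have e: "g x \<in> edges H" if "x \<in> edges G" for x
    using assms(1) that by (auto simp: network_iso_def graph_iso_def bij_betw_def)
  show ?thesis
    using assms v e
    by (auto simp: network_iso_def graph_iso_def intro: bij_betw_trans)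
qed

lemma network_iso_inv:
  assumes "network_iso f g G H" "network G"
  shows "network_iso (inv_into (verts G) f) (inv_into (edges G) g) H G"
proof -
  let ?f = "inv_into (verts G) f" and ?g = "inv_into (edges G) g"
  have bf: "bij_betw f (verts G) (verts H)" and bg: "bij_betw g (edges G) (edges H)"
    and en: "\<And>e. e \<in> edges G \<Longrightarrow> ends H (g e) = f ` ends G e"
    and vm: "\<And>v. v \<in> verts G \<Longrightarrow> vmark H (f v) = vmark G v"
    and em: "\<And>e v. e \<in> edges G \<Longrightarrow> v \<in> ends G e \<Longrightarrow> emark H (f v) (g e) = emark G v e"
    using assms(1) by (auto simp: network_iso_def graph_iso_def)
  have sub: "ends G e \<subseteq> verts G" if "e \<in> edges G" for e
    using assms(2) that by (auto simp: network_def)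
  have fi: "?f (f v) = v" if "v \<in> verts G" for v
    using bf that by (simp add: bij_betw_inv_into_left)
  have gi: "?g (g e) = e" if "e \<in> edges G" for e
    using bg that by (simp add: bij_betw_inv_into_left)
  have fi': "?f ` f ` X = X" if "X \<subseteq> verts G" for X
    using fi that by (force simp: image_image)
  have eH: "edges H = g ` edges G" and vH: "verts H = f ` verts G"
    using bf bg by (auto simp: bij_betw_def)
  show ?thesis
    unfolding network_iso_def graph_iso_def
    using bij_betw_inv_into[OF bf] bij_betw_inv_into[OF bg] sub
    by (auto simp: eH vH en fi gi fi' vm em subset_iff)
qed

lemma network_iso_inv_apply:
  assumes "network_iso f g G H" "v \<in> verts G"
  shows "inv_into (verts G) f (f v) = v"
  using assms by (auto simp: network_iso_def graph_iso_def bij_betw_inv_into_left)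

definition point_net :: "(nat, nat, 'm) marked_graph" where
  "point_net = \<lparr>verts = {0}, edges = {}, ends = (\<lambda>_. {}), vmark = (\<lambda>_. undefined),
                emark = (\<lambda>_ _. undefined)\<rparr>"

lemma network_point_net: "network point_net"
  by (simp add: network_def point_net_def)

quotient_type 'm unrooted_net = "(nat, nat, 'm) marked_graph" / partial: unrooted_iso
proof (rule part_equivpI)
  show "\<exists>x. unrooted_iso x x"
    using network_point_net network_iso_id by (auto simp: unrooted_iso_def)
  show "symp unrooted_iso"
    by (auto simp: symp_def unrooted_iso_def intro: network_iso_inv)
  show "transp unrooted_iso"
    by (auto simp: transp_def unrooted_iso_def intro: network_iso_comp)
qed

quotient_type 'm rooted_net = "(nat, nat, 'm) marked_graph \<times> nat" / partial: rooted_iso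
proof (rule part_equivpI)
  have "rooted_iso (point_net, 0) (point_net, 0)"
    using network_point_net network_iso_id
    by (auto simp: rooted_iso_def point_net_def intro!: exI[of _ id])
  then show "\<exists>x. rooted_iso x x" ..
  show "symp rooted_iso"
  proof (rule sympI)
    fix x y assume "rooted_iso x y"
    then show "rooted_iso y x"
      using network_iso_inv network_iso_inv_apply
      unfolding rooted_iso_def by (fastforce split: prod.splits)
  qed
  show "transp rooted_iso"
  proof (rule transpI)
    fix x y z assume "rooted_iso x y" "rooted_iso y z"
    then show "rooted_iso x z"
      unfolding rooted_iso_def by clarsimp (metis comp_apply network_iso_comp)
  qed
qed

quotient_type 'm birooted_net = "(nat, nat, 'm) marked_graph \<times> nat \<times> nat" / partial: birooted_iso
proof (rule part_equivpI)
  have "birooted_iso (point_net, 0, 0) (point_net, 0, 0)"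
    using network_point_net network_iso_id
    by (auto simp: birooted_iso_def point_net_def intro!: exI[of _ id])
  then show "\<exists>x. birooted_iso x x" ..
  show "symp birooted_iso"
  proof (rule sympI)
    fix x y assume "birooted_iso x y"
    then show "birooted_iso y x"
      using network_iso_inv network_iso_inv_apply
      unfolding birooted_iso_def by (fastforce split: prod.splits)
  qed
  show "transp birooted_iso"
  proof (rule transpI)
    fix x y z assume "birooted_iso x y" "birooted_iso y z"
    then show "birooted_iso x z"
      unfolding birooted_iso_def by clarsimp (metis comp_apply network_iso_comp)
  qed
qed


abbreviation net_class :: "(nat, nat, 'm) marked_graph \<Rightarrow> 'm unrooted_net" where
  "net_class G \<equiv> abs_unrooted_net G"

abbreviation rooted_class :: "(nat, nat, 'm) marked_graph \<Rightarrow> nat \<Rightarrow> 'm rooted_net" where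
  "rooted_class G p \<equiv> abs_rooted_net (G, p)"

abbreviation birooted_class ::
  "(nat, nat, 'm) marked_graph \<Rightarrow> nat \<Rightarrow> nat \<Rightarrow> 'm birooted_net" where
  "birooted_class G p v \<equiv> abs_birooted_net (G, p, v)"

lemma rooted_class_eq_iff:
  assumes "network G" "p \<in> verts G" "network H" "q \<in> verts H"
  shows "rooted_class G p = rooted_class H q \<longleftrightarrow> (\<exists>f g. network_iso f g G H \<and> f p = q)"
proof -
  have refl: "rooted_iso (K, k) (K, k)" if "network K" "k \<in> verts K"
    for K :: "(nat, nat, 'a) marked_graph" and k
    using that network_iso_id by (auto simp: rooted_iso_def intro!: exI[of _ id])
  have "rooted_class G p = rooted_class H q \<longleftrightarrow> rooted_iso (G, p) (H, q)"
    using Quotient3_rel[OF Quotient3_rooted_net, of "(G, p)" "(H, q)"] refl assms by simp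
  then show ?thesis using assms by (auto simp: rooted_iso_def)
qed

lemma birooted_class_eq_iff:
  assumes "network G" "p \<in> verts G" "v \<in> verts G" "network H" "q \<in> verts H" "w \<in> verts H"
  shows "birooted_class G p v = birooted_class H q w \<longleftrightarrow>
         (\<exists>f g. network_iso f g G H \<and> f p = q \<and> f v = w)"
proof -
  have refl: "birooted_iso (K, k, l) (K, k, l)" if "network K" "k \<in> verts K" "l \<in> verts K"
    for K :: "(nat, nat, 'a) marked_graph" and k l
    using that network_iso_id by (auto simp: birooted_iso_def intro!: exI[of _ id])
  have "birooted_class G p v = birooted_class H q w \<longleftrightarrow> birooted_iso (G, p, v) (H, q, w)"
    using Quotient3_rel[OF Quotient3_birooted_net, of "(G, p, v)" "(H, q, w)"] refl assms by simp
  then show ?thesis using assms by (auto simp: birooted_iso_def)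
qed

lift_definition unroot :: "'m rooted_net \<Rightarrow> 'm unrooted_net" is fst
  unfolding rooted_iso_def unrooted_iso_def by (clarsimp, blast)

lift_definition sum_from_root ::
  "('m birooted_net \<Rightarrow> ennreal) \<Rightarrow> 'm rooted_net \<Rightarrow> ennreal" is
  "\<lambda>g (G, p). \<integral>\<^sup>+ v. g (birooted_class G p v) \<partial>count_space (verts G)"
proof -
  fix g :: "'m birooted_net \<Rightarrow> ennreal" and x y :: "(nat, nat, 'm) marked_graph \<times> nat"
  assume "rooted_iso x y"
  then obtain G p H q f h where *: "x = (G, p)" "y = (H, q)" "network G" "network H"
    "p \<in> verts G" "q \<in> verts H" "network_iso f h G H" "f p = q"
    by (cases x, cases y) (auto simp: rooted_iso_def)
  have bij: "bij_betw f (verts G) (verts H)"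
    using * by (auto simp: network_iso_def graph_iso_def)
  have "(\<integral>\<^sup>+ v. g (birooted_class G p v) \<partial>count_space (verts G)) =
        (\<integral>\<^sup>+ v. g (birooted_class H q (f v)) \<partial>count_space (verts G))"
  proof (rule nn_integral_cong)
    fix v assume "v \<in> space (count_space (verts G))"
    then have "v \<in> verts G" "f v \<in> verts H" using bij by (auto simp: bij_betw_def)
    then have "birooted_class G p v = birooted_class H q (f v)"
      using * birooted_class_eq_iff by blast
    then show "g (birooted_class G p v) = g (birooted_class H q (f v))" by simp
  qed
  also have "\<dots> = (\<integral>\<^sup>+ v. g (birooted_class H q v) \<partial>count_space (verts H))"
    by (rule nn_integral_bij_count_space[OF bij])
  finally show "(case x of (G, p) \<Rightarrow> \<integral>\<^sup>+ v. g (birooted_class G p v) \<partial>count_space (verts G)) =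
       (case y of (G, p) \<Rightarrow> \<integral>\<^sup>+ v. g (birooted_class G p v) \<partial>count_space (verts G))"
    using * by simp
qed

lift_definition sum_to_root ::
  "('m birooted_net \<Rightarrow> ennreal) \<Rightarrow> 'm rooted_net \<Rightarrow> ennreal" is
  "\<lambda>g (G, p). \<integral>\<^sup>+ v. g (birooted_class G v p) \<partial>count_space (verts G)"
proof -
  fix g :: "'m birooted_net \<Rightarrow> ennreal" and x y :: "(nat, nat, 'm) marked_graph \<times> nat"
  assume "rooted_iso x y"
  then obtain G p H q f h where *: "x = (G, p)" "y = (H, q)" "network G" "network H"
    "p \<in> verts G" "q \<in> verts H" "network_iso f h G H" "f p = q"
    by (cases x, cases y) (auto simp: rooted_iso_def)
  have bij: "bij_betw f (verts G) (verts H)"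
    using * by (auto simp: network_iso_def graph_iso_def)
  have "(\<integral>\<^sup>+ v. g (birooted_class G v p) \<partial>count_space (verts G)) =
        (\<integral>\<^sup>+ v. g (birooted_class H (f v) q) \<partial>count_space (verts G))"
  proof (rule nn_integral_cong)
    fix v assume "v \<in> space (count_space (verts G))"
    then have "v \<in> verts G" "f v \<in> verts H" using bij by (auto simp: bij_betw_def)
    then have "birooted_class G v p = birooted_class H (f v) q"
      using * birooted_class_eq_iff by blast
    then show "g (birooted_class G v p) = g (birooted_class H (f v) q)" by simp
  qed
  also have "\<dots> = (\<integral>\<^sup>+ v. g (birooted_class H v q) \<partial>count_space (verts H))"
    by (rule nn_integral_bij_count_space[OF bij])
  finally show "(case x of (G, p) \<Rightarrow> \<integral>\<^sup>+ v. g (birooted_class G v p) \<partial>count_space (verts G)) =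
       (case y of (G, p) \<Rightarrow> \<integral>\<^sup>+ v. g (birooted_class G v p) \<partial>count_space (verts G))"
    using * by simp
qed


section \<open>Local topologies\<close>

lemma relpow_adj_in_verts:
  assumes "network G" "(p, v) \<in> adj G ^^ k" "p \<in> verts G"
  shows "v \<in> verts G"
  using assms by (cases k) (auto simp: network_def adj_def)

lemma gdist_relpow:
  assumes "network G" "p \<in> verts G" "v \<in> verts G"
  shows "(p, v) \<in> adj G ^^ gdist G p v"
proof -
  have "(p, v) \<in> (adj G)\<^sup>*" using assms by (simp add: network_def)
  then obtain n where "(p, v) \<in> adj G ^^ n" using rtrancl_imp_relpow by blast
  then show ?thesis unfolding gdist_def by (rule LeastI)
qed

lemma gdist_le: "(p, v) \<in> adj G ^^ n \<Longrightarrow> gdist G p v \<le> n"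
  unfolding gdist_def by (rule Least_le)

lemma root_in_ball: "p \<in> verts G \<Longrightarrow> p \<in> ball_verts G p r"
  using gdist_le[of p p 0 G] by (simp add: ball_verts_def)

lemma graph_ball_sel [simp]:
  "verts (graph_ball G p r) = ball_verts G p r"
  "edges (graph_ball G p r) = {e \<in> edges G. ends G e \<subseteq> ball_verts G p r}"
  "ends (graph_ball G p r) = ends G"
  "vmark (graph_ball G p r) = vmark G"
  "emark (graph_ball G p r) = emark G"
  by (simp_all add: graph_ball_def)

lemma graph_iso_ball_gdist_le:
  assumes iso: "graph_iso f g (graph_ball G p r) (graph_ball H (f p) r)"
    and G: "network G" "p \<in> verts G" and v: "v \<in> ball_verts G p r"
  shows "gdist H (f p) (f v) \<le> gdist G p v"
proof -
  have "(f p, f v) \<in> adj H ^^ k" if "(p, v) \<in> adj G ^^ k" "k \<le> r" for k v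
    using that
  proof (induction k arbitrary: v)
    case (Suc k)
    then obtain u where u: "(p, u) \<in> adj G ^^ k" "(u, v) \<in> adj G" by auto
    then obtain e where e: "e \<in> edges G" "ends G e = {u, v}" by (auto simp: adj_def)
    have "u \<in> verts G" "v \<in> verts G"
      using relpow_adj_in_verts[OF G(1) _ G(2)] u(1) Suc.prems(1) by blast+
    moreover have "gdist G p u \<le> r" "gdist G p v \<le> r"
      using gdist_le[OF u(1)] gdist_le[OF Suc.prems(1)] Suc.prems(2) by linarith+
    ultimately have "e \<in> edges (graph_ball G p r)" using e by (simp add: ball_verts_def)
    then have "g e \<in> edges (graph_ball H (f p) r)" "ends H (g e) = f ` {u, v}"
      using iso e by (auto simp: graph_iso_def bij_betw_def)
    then have "(f u, f v) \<in> adj H" by (auto simp: adj_def)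
    moreover have "(f p, f u) \<in> adj H ^^ k" using Suc u by simp
    ultimately show ?case by auto
  qed simp
  then have "(f p, f v) \<in> adj H ^^ gdist G p v"
    using gdist_relpow[OF G] v by (simp add: ball_verts_def)
  then show ?thesis by (rule gdist_le)
qed

lemma graph_iso_inv:
  assumes "graph_iso f g G H" "\<And>e. e \<in> edges G \<Longrightarrow> ends G e \<subseteq> verts G"
  shows "graph_iso (inv_into (verts G) f) (inv_into (edges G) g) H G"
proof -
  have bf: "bij_betw f (verts G) (verts H)" and bg: "bij_betw g (edges G) (edges H)"
    and en: "\<And>e. e \<in> edges G \<Longrightarrow> ends H (g e) = f ` ends G e"
    using assms(1) by (auto simp: graph_iso_def)
  have fi: "inv_into (verts G) f ` f ` X = X" if "X \<subseteq> verts G" for X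
    using bf that by (simp add: bij_betw_def inv_into_image_cancel)
  have gi: "inv_into (edges G) g (g e) = e" if "e \<in> edges G" for e
    using bg that by (simp add: bij_betw_inv_into_left)
  have eH: "edges H = g ` edges G" using bg by (auto simp: bij_betw_def)
  show ?thesis
    unfolding graph_iso_def
    using bij_betw_inv_into[OF bf] bij_betw_inv_into[OF bg] assms(2)
    by (auto simp: eH en fi gi simp del: image_eqI)
qed

lemma graph_iso_ball_gdist:
  assumes iso: "graph_iso f g (graph_ball G p r) (graph_ball H (f p) r)"
    and G: "network G" "p \<in> verts G" and H: "network H" "f p \<in> verts H"
    and v: "v \<in> ball_verts G p r"
  shows "gdist H (f p) (f v) = gdist G p v"
proof (rule antisym)
  show "gdist H (f p) (f v) \<le> gdist G p v"
    by (rule graph_iso_ball_gdist_le[OF iso G v])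
  let ?f = "inv_into (verts (graph_ball G p r)) f"
  let ?g = "inv_into (edges (graph_ball G p r)) g"
  have bf: "bij_betw f (ball_verts G p r) (ball_verts H (f p) r)"
    using iso by (simp add: graph_iso_def)
  have fi: "?f (f u) = u" if "u \<in> ball_verts G p r" for u
    using bf that by (simp add: bij_betw_inv_into_left)
  have "graph_iso ?f ?g (graph_ball H (f p) r) (graph_ball G p r)"
    by (rule graph_iso_inv[OF iso]) simp
  then have "graph_iso ?f ?g (graph_ball H (f p) r) (graph_ball G (?f (f p)) r)"
    using fi root_in_ball[OF G(2)] by metis
  moreover have "f v \<in> ball_verts H (f p) r" using bf v by (auto simp: bij_betw_def)
  ultimately have "gdist G (?f (f p)) (?f (f v)) \<le> gdist H (f p) (f v)"
    using graph_iso_ball_gdist_le[OF _ H] by blast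
  then show "gdist G p v \<le> gdist H (f p) (f v)"
    using fi root_in_ball[OF G(2)] v by metis
qed

lemma ball_iso_within_restrict:
  assumes *: "ball_iso_within R \<epsilon> f g G p H q" and r: "r \<le> R" and \<epsilon>: "\<epsilon> \<le> \<epsilon>'"
    and nets: "network G" "p \<in> verts G" "network H" "q \<in> verts H"
  shows "ball_iso_within r \<epsilon>' f g G p H q"
proof -
  have iso: "graph_iso f g (graph_ball G p R) (graph_ball H q R)" and fp: "f p = q"
    and m: "marks_within \<epsilon> f g (graph_ball G p R) (graph_ball H q R)"
    using * by (auto simp: ball_iso_within_def)
  have sub: "ball_verts G p r \<subseteq> ball_verts G p R" "ball_verts H q r \<subseteq> ball_verts H q R"
    using r by (auto simp: ball_verts_def)
  have bf: "bij_betw f (ball_verts G p R) (ball_verts H q R)"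
    and bg: "bij_betw g (edges (graph_ball G p R)) (edges (graph_ball H q R))"
    and en: "\<And>e. e \<in> edges (graph_ball G p R) \<Longrightarrow> ends H (g e) = f ` ends G e"
    using iso by (auto simp: graph_iso_def)
  have d: "gdist H q (f v) = gdist G p v" if "v \<in> ball_verts G p R" for v
    using graph_iso_ball_gdist[of f g G p R H v] iso fp nets that by simp
  have mem: "f v \<in> ball_verts H q r \<longleftrightarrow> v \<in> ball_verts G p r" if "v \<in> ball_verts G p R" for v
    using d[OF that] that bf by (auto simp: ball_verts_def bij_betw_def)
  have "f ` ball_verts G p r = ball_verts H q r"
  proof
    show "f ` ball_verts G p r \<subseteq> ball_verts H q r" using mem sub by auto
    show "ball_verts H q r \<subseteq> f ` ball_verts G p r"
    proof
      fix w assume w: "w \<in> ball_verts H q r"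
      then obtain v where "v \<in> ball_verts G p R" "w = f v"
        using bf sub unfolding bij_betw_def by blast
      then show "w \<in> f ` ball_verts G p r" using mem w by auto
    qed
  qed
  then have bf': "bij_betw f (ball_verts G p r) (ball_verts H q r)"
    using bf sub by (auto simp: bij_betw_def intro: inj_on_subset)
  have esub: "edges (graph_ball G p r) \<subseteq> edges (graph_ball G p R)"
    "edges (graph_ball H q r) \<subseteq> edges (graph_ball H q R)"
    using sub by auto
  have emem: "g e \<in> edges (graph_ball H q r) \<longleftrightarrow> e \<in> edges (graph_ball G p r)"
    if "e \<in> edges (graph_ball G p R)" for e
  proof -
    have "g e \<in> edges (graph_ball H q R)" using bg that by (auto simp: bij_betw_def)
    moreover have "f ` ends G e \<subseteq> ball_verts H q r \<longleftrightarrow> ends G e \<subseteq> ball_verts G p r"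
      using that mem by auto
    ultimately show ?thesis using that en[OF that] by auto
  qed
  have "g ` edges (graph_ball G p r) = edges (graph_ball H q r)"
  proof
    show "g ` edges (graph_ball G p r) \<subseteq> edges (graph_ball H q r)" using emem esub by blast
    show "edges (graph_ball H q r) \<subseteq> g ` edges (graph_ball G p r)"
    proof
      fix h assume h: "h \<in> edges (graph_ball H q r)"
      then obtain e where "e \<in> edges (graph_ball G p R)" "h = g e"
        using bg esub unfolding bij_betw_def by blast
      then show "h \<in> g ` edges (graph_ball G p r)" using emem h by blast
    qed
  qed
  then have bg': "bij_betw g (edges (graph_ball G p r)) (edges (graph_ball H q r))"
    using bg esub unfolding bij_betw_def by (blast intro: inj_on_subset)
  have "graph_iso f g (graph_ball G p r) (graph_ball H q r)"
    unfolding graph_iso_def using bf' bg' en esub by auto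
  moreover have "marks_within \<epsilon>' f g (graph_ball G p r) (graph_ball H q r)"
    using m sub \<epsilon> unfolding marks_within_def by (simp add: subset_iff) (meson less_le_trans)
  ultimately show ?thesis using fp by (simp add: ball_iso_within_def)
qed

definition rooted_nbhd ::
  "nat \<Rightarrow> real \<Rightarrow> (nat, nat, 'm::metric_space) marked_graph \<Rightarrow> nat \<Rightarrow> 'm rooted_net set" where
  "rooted_nbhd r \<epsilon> G p =
     {rooted_class H q |H q. network H \<and> q \<in> verts H \<and> (\<exists>f g. ball_iso_within r \<epsilon> f g G p H q)}"

definition birooted_nbhd ::
  "nat \<Rightarrow> real \<Rightarrow> (nat, nat, 'm::metric_space) marked_graph \<Rightarrow> nat \<Rightarrow> nat \<Rightarrow> 'm birooted_net set"
  where
  "birooted_nbhd r \<epsilon> G p v =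
     {birooted_class H q w |H q w. network H \<and> q \<in> verts H \<and> w \<in> verts H \<and>
        (\<exists>f g. ball_iso_within r \<epsilon> f g G p H q \<and> f v = w)}"

lemma rooted_nbhdI:
  "network H \<Longrightarrow> q \<in> verts H \<Longrightarrow> ball_iso_within r \<epsilon> f g G p H q \<Longrightarrow>
   rooted_class H q \<in> rooted_nbhd r \<epsilon> G p"
  unfolding rooted_nbhd_def by blast

lemma rooted_nbhdE:
  assumes "x \<in> rooted_nbhd r \<epsilon> G p"
  obtains H q f g where "network H" "q \<in> verts H" "x = rooted_class H q"
    "ball_iso_within r \<epsilon> f g G p H q"
  using assms unfolding rooted_nbhd_def by blast

lemma birooted_nbhdI:
  "network H \<Longrightarrow> q \<in> verts H \<Longrightarrow> w \<in> verts H \<Longrightarrow> ball_iso_within r \<epsilon> f g G p H q \<Longrightarrow> f v = w \<Longrightarrow>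
   birooted_class H q w \<in> birooted_nbhd r \<epsilon> G p v"
  unfolding birooted_nbhd_def by blast

lemma birooted_nbhdE:
  assumes "x \<in> birooted_nbhd r \<epsilon> G p v"
  obtains H q w f g where "network H" "q \<in> verts H" "w \<in> verts H" "x = birooted_class H q w"
    "ball_iso_within r \<epsilon> f g G p H q" "f v = w"
  using assms unfolding birooted_nbhd_def by blast

lemma rooted_nbhd_mono:
  assumes "network G" "p \<in> verts G" "r \<le> R" "\<epsilon> \<le> \<epsilon>'"
  shows "rooted_nbhd R \<epsilon> G p \<subseteq> rooted_nbhd r \<epsilon>' G p"
proof
  fix x assume "x \<in> rooted_nbhd R \<epsilon> G p"
  then obtain H q f g where H: "network H" "q \<in> verts H" "x = rooted_class H q"
    "ball_iso_within R \<epsilon> f g G p H q" by (rule rooted_nbhdE)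
  show "x \<in> rooted_nbhd r \<epsilon>' G p"
    unfolding H(3) by (rule rooted_nbhdI[OF H(1,2) ball_iso_within_restrict[OF H(4) assms(3,4,1,2) H(1,2)]])
qed

lemma birooted_nbhd_mono:
  assumes "network G" "p \<in> verts G" "r \<le> R" "\<epsilon> \<le> \<epsilon>'"
  shows "birooted_nbhd R \<epsilon> G p v \<subseteq> birooted_nbhd r \<epsilon>' G p v"
proof
  fix x assume "x \<in> birooted_nbhd R \<epsilon> G p v"
  then obtain H q w f g where H: "network H" "q \<in> verts H" "w \<in> verts H"
    "x = birooted_class H q w" "ball_iso_within R \<epsilon> f g G p H q" "f v = w"
    by (rule birooted_nbhdE)
  show "x \<in> birooted_nbhd r \<epsilon>' G p v"
    unfolding H(4)
    by (rule birooted_nbhdI[OF H(1,2,3) ball_iso_within_restrict[OF H(5) assms(3,4,1,2) H(1,2)] H(6)])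
qed

instantiation rooted_net :: (metric_space) topological_space
begin

definition open_rooted_net :: "'a rooted_net set \<Rightarrow> bool" where
  "open_rooted_net U \<longleftrightarrow>
     (\<forall>G p. network G \<and> p \<in> verts G \<and> rooted_class G p \<in> U \<longrightarrow>
       (\<exists>r. \<exists>\<epsilon>>0. rooted_nbhd r \<epsilon> G p \<subseteq> U))"

instance
proof
  show "open (UNIV :: 'a rooted_net set)" by (auto simp: open_rooted_net_def intro: exI[of _ 1])
next
  fix S T :: "'a rooted_net set" assume ST: "open S" "open T"
  show "open (S \<inter> T)"
    unfolding open_rooted_net_def
  proof (intro allI impI)
    fix G :: "(nat, nat, 'a) marked_graph" and p
    assume G: "network G \<and> p \<in> verts G \<and> rooted_class G p \<in> S \<inter> T"
    obtain r1 e1 where 1: "0 < e1" "rooted_nbhd r1 e1 G p \<subseteq> S"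
      using ST(1) G unfolding open_rooted_net_def by blast
    obtain r2 e2 where 2: "0 < e2" "rooted_nbhd r2 e2 G p \<subseteq> T"
      using ST(2) G unfolding open_rooted_net_def by blast
    have "rooted_nbhd (max r1 r2) (min e1 e2) G p \<subseteq> rooted_nbhd r1 e1 G p"
      "rooted_nbhd (max r1 r2) (min e1 e2) G p \<subseteq> rooted_nbhd r2 e2 G p"
      using G by (simp_all add: rooted_nbhd_mono)
    then have "0 < min e1 e2 \<and> rooted_nbhd (max r1 r2) (min e1 e2) G p \<subseteq> S \<inter> T"
      using 1 2 by auto
    then show "\<exists>r. \<exists>\<epsilon>>0. rooted_nbhd r \<epsilon> G p \<subseteq> S \<inter> T" by blast
  qed
next
  fix K :: "'a rooted_net set set" assume "\<forall>S\<in>K. open S"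
  then show "open (\<Union>K)" unfolding open_rooted_net_def by (meson Union_iff Union_upper subset_trans)
qed

end

instantiation birooted_net :: (metric_space) topological_space
begin

definition open_birooted_net :: "'a birooted_net set \<Rightarrow> bool" where
  "open_birooted_net U \<longleftrightarrow>
     (\<forall>G p v. network G \<and> p \<in> verts G \<and> v \<in> verts G \<and> birooted_class G p v \<in> U \<longrightarrow>
       (\<exists>r\<ge>gdist G p v. \<exists>\<epsilon>>0. birooted_nbhd r \<epsilon> G p v \<subseteq> U))"

instance
proof
  show "open (UNIV :: 'a birooted_net set)"
    by (auto simp: open_birooted_net_def intro: exI[of _ 1])
next
  fix S T :: "'a birooted_net set" assume ST: "open S" "open T"
  show "open (S \<inter> T)"
    unfolding open_birooted_net_def
  proof (intro allI impI)
    fix G :: "(nat, nat, 'a) marked_graph" and p v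
    assume G: "network G \<and> p \<in> verts G \<and> v \<in> verts G \<and> birooted_class G p v \<in> S \<inter> T"
    obtain r1 e1 where 1: "gdist G p v \<le> r1" "0 < e1" "birooted_nbhd r1 e1 G p v \<subseteq> S"
      using ST(1) G unfolding open_birooted_net_def by blast
    obtain r2 e2 where 2: "gdist G p v \<le> r2" "0 < e2" "birooted_nbhd r2 e2 G p v \<subseteq> T"
      using ST(2) G unfolding open_birooted_net_def by blast
    have "birooted_nbhd (max r1 r2) (min e1 e2) G p v \<subseteq> birooted_nbhd r1 e1 G p v"
      "birooted_nbhd (max r1 r2) (min e1 e2) G p v \<subseteq> birooted_nbhd r2 e2 G p v"
      using G by (simp_all add: birooted_nbhd_mono)
    then have "gdist G p v \<le> max r1 r2 \<and> 0 < min e1 e2 \<and>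
        birooted_nbhd (max r1 r2) (min e1 e2) G p v \<subseteq> S \<inter> T"
      using 1 2 by auto
    then show "\<exists>r\<ge>gdist G p v. \<exists>\<epsilon>>0. birooted_nbhd r \<epsilon> G p v \<subseteq> S \<inter> T" by blast
  qed
next
  fix K :: "'a birooted_net set set" assume "\<forall>S\<in>K. open S"
  then show "open (\<Union>K)" unfolding open_birooted_net_def by (meson Union_iff Union_upper subset_trans)
qed

end

lemma network_ends:
  assumes "network G" "e \<in> edges G"
  shows "ends G e \<subseteq> verts G" "finite (ends G e)" "ends G e \<noteq> {}"
proof -
  have *: "ends G e \<subseteq> verts G" "card (ends G e) \<in> {1, 2}"
    using assms unfolding network_def by blast+
  show "ends G e \<subseteq> verts G" by (rule *)
  have "card (ends G e) \<noteq> 0" using *(2) by auto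
  then show "finite (ends G e)" "ends G e \<noteq> {}" by (auto intro: card_ge_0_finite)
qed

lemma finite_ball_verts:
  assumes "network G" "p \<in> verts G"
  shows "finite (ball_verts G p r)"
proof -
  have nb: "finite {w. (u, w) \<in> adj G}" if "u \<in> verts G" for u
  proof -
    have "{w. (u, w) \<in> adj G} \<subseteq> (\<Union>e\<in>{e \<in> edges G. u \<in> ends G e}. ends G e)"
      by (auto simp: adj_def)
    moreover have "finite {e \<in> edges G. u \<in> ends G e}"
      using assms(1) that by (simp add: network_def)
    ultimately show ?thesis
      by (elim finite_subset) (simp add: network_ends(2)[OF assms(1)])
  qed
  have fin: "finite {v. (p, v) \<in> adj G ^^ k}" for k
  proof (induction k)
    case (Suc k)
    have "{v. (p, v) \<in> adj G ^^ Suc k} \<subseteq> (\<Union>u\<in>{v. (p, v) \<in> adj G ^^ k}. {w. (u, w) \<in> adj G})"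
      by auto
    moreover have "finite \<dots>"
      using Suc nb relpow_adj_in_verts[OF assms(1) _ assms(2)] by (intro finite_UN_I) auto
    ultimately show ?case by (rule finite_subset)
  qed simp
  have "ball_verts G p r \<subseteq> (\<Union>k\<le>r. {v. (p, v) \<in> adj G ^^ k})"
    using gdist_relpow[OF assms] by (auto simp: ball_verts_def)
  then show ?thesis by (rule finite_subset) (simp add: fin)
qed

lemma finite_ball_edges:
  assumes "network G" "p \<in> verts G"
  shows "finite (edges (graph_ball G p r))"
proof -
  have "edges (graph_ball G p r) \<subseteq> (\<Union>v\<in>ball_verts G p r. {e \<in> edges G. v \<in> ends G e})"
  proof
    fix e assume e: "e \<in> edges (graph_ball G p r)"
    then obtain v where "v \<in> ends G e" using network_ends(3)[OF assms(1), of e] by auto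
    then show "e \<in> (\<Union>v\<in>ball_verts G p r. {e \<in> edges G. v \<in> ends G e})" using e by auto
  qed
  moreover have "finite \<dots>"
  proof (rule finite_UN_I[OF finite_ball_verts[OF assms]])
    show "finite {e \<in> edges G. v \<in> ends G e}" if "v \<in> ball_verts G p r" for v
      using that assms(1) by (simp add: network_def ball_verts_def)
  qed
  ultimately show ?thesis by (rule finite_subset)
qed

lemma ball_iso_within_refl: "0 < \<epsilon> \<Longrightarrow> ball_iso_within r \<epsilon> id id G p G p"
  by (simp add: ball_iso_within_def graph_iso_def marks_within_def)

lemma ball_iso_within_comp:
  assumes fg: "ball_iso_within r \<epsilon> f g G p H q" and G: "network G" "p \<in> verts G"
    and \<epsilon>: "0 < \<epsilon>"
  obtains \<delta> where "0 < \<delta>"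
    "\<And>f' g' K k. ball_iso_within r \<delta> f' g' H q K k \<Longrightarrow> ball_iso_within r \<epsilon> (f' \<circ> f) (g' \<circ> g) G p K k"
proof -
  let ?B = "graph_ball G p r" and ?C = "graph_ball H q r"
  have iso: "graph_iso f g ?B ?C" and fp: "f p = q" and m: "marks_within \<epsilon> f g ?B ?C"
    using fg by (auto simp: ball_iso_within_def)
  define D where "D = insert 0 ((\<lambda>v. dist (vmark G v) (vmark H (f v))) ` verts ?B \<union>
    (\<Union>e\<in>edges ?B. (\<lambda>v. dist (emark G v e) (emark H (f v) (g e))) ` ends G e))"
  have fe: "finite (ends G e)" if "e \<in> edges ?B" for e
    using that by (auto intro: finite_subset[OF _ finite_ball_verts[OF G, of r]])
  have fin: "finite D"
    unfolding D_def
    using finite_ball_verts[OF G, of r] finite_ball_edges[OF G, of r] fe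
    by (intro finite.insertI finite_UnI finite_imageI finite_UN_I) simp_all
  have lt: "d < \<epsilon>" if "d \<in> D" for d
    using that m \<epsilon> unfolding D_def marks_within_def by auto
  have D0: "D \<noteq> {}" by (simp add: D_def)
  define \<delta> where "\<delta> = \<epsilon> - Max D"
  have pos: "0 < \<delta>" using lt[OF Max_in[OF fin D0]] by (simp add: \<delta>_def)
  have le: "d \<le> \<epsilon> - \<delta>" if "d \<in> D" for d
    using Max_ge[OF fin that] by (simp add: \<delta>_def)
  have "ball_iso_within r \<epsilon> (f' \<circ> f) (g' \<circ> g) G p K k"
    if *: "ball_iso_within r \<delta> f' g' H q K k" for f' g' K k
  proof -
    let ?E = "graph_ball K k r"
    have iso': "graph_iso f' g' ?C ?E" and fp': "f' q = k" and m': "marks_within \<delta> f' g' ?C ?E"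
      using * by (auto simp: ball_iso_within_def)
    have v: "f u \<in> verts ?C" if "u \<in> verts ?B" for u
      using iso that by (auto simp: graph_iso_def bij_betw_def)
    have e: "g x \<in> edges ?C" "ends H (g x) = f ` ends G x" if "x \<in> edges ?B" for x
      using iso that unfolding graph_iso_def bij_betw_def by auto
    have "bij_betw (f' \<circ> f) (verts ?B) (verts ?E)" "bij_betw (g' \<circ> g) (edges ?B) (edges ?E)"
      using iso iso' by (auto simp only: graph_iso_def intro: bij_betw_trans)
    moreover have "ends K ((g' \<circ> g) x) = (f' \<circ> f) ` ends G x" if "x \<in> edges ?B" for x
      using e[OF that] iso' by (simp add: graph_iso_def image_comp)
    ultimately have "graph_iso (f' \<circ> f) (g' \<circ> g) ?B ?E" unfolding graph_iso_def by simp
    moreover have "dist (vmark G u) (vmark K (f' (f u))) < \<epsilon>" if "u \<in> verts ?B" for u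
    proof -
      have "dist (vmark G u) (vmark H (f u)) \<in> D" using that by (auto simp: D_def)
      then have "dist (vmark G u) (vmark H (f u)) \<le> \<epsilon> - \<delta>" by (rule le)
      moreover have "dist (vmark H (f u)) (vmark K (f' (f u))) < \<delta>"
        using m' v[OF that] by (simp add: marks_within_def)
      ultimately show ?thesis
        using dist_triangle[of "vmark G u" "vmark K (f' (f u))" "vmark H (f u)"] by linarith
    qed
    moreover have "dist (emark G u x) (emark K (f' (f u)) (g' (g x))) < \<epsilon>"
      if "x \<in> edges ?B" "u \<in> ends G x" for x u
    proof -
      have "dist (emark G u x) (emark H (f u) (g x)) \<in> D"
        unfolding D_def using that by blast
      then have "dist (emark G u x) (emark H (f u) (g x)) \<le> \<epsilon> - \<delta>" by (rule le)
      moreover have "dist (emark H (f u) (g x)) (emark K (f' (f u)) (g' (g x))) < \<delta>"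
        using m' e[OF that(1)] that(2) by (simp add: marks_within_def)
      ultimately show ?thesis
        using dist_triangle[of "emark G u x" "emark K (f' (f u)) (g' (g x))" "emark H (f u) (g x)"]
        by linarith
    qed
    ultimately show ?thesis using fp fp' by (auto simp: ball_iso_within_def marks_within_def)
  qed
  then show thesis by (rule that[OF pos])
qed

lemma network_iso_ball_iso_within:
  assumes iso: "network_iso f g G H" "f p = q" and \<epsilon>: "0 < \<epsilon>"
    and nets: "network G" "p \<in> verts G" "network H" "q \<in> verts H"
  shows "ball_iso_within r \<epsilon> f g G p H q"
proof -
  have bf: "bij_betw f (verts G) (verts H)" and bg: "bij_betw g (edges G) (edges H)"
    and en: "\<And>e. e \<in> edges G \<Longrightarrow> ends H (g e) = f ` ends G e"
    using iso by (auto simp: network_iso_def graph_iso_def)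
  have sub: "ends G e \<subseteq> verts G" if "e \<in> edges G" for e
    using nets that by (auto simp: network_def)
  have adj: "(f u, f v) \<in> adj H \<longleftrightarrow> (u, v) \<in> adj G" if uv: "u \<in> verts G" "v \<in> verts G" for u v
  proof
    assume "(f u, f v) \<in> adj H"
    then obtain h where "h \<in> edges H" "ends H h = {f u, f v}" by (auto simp: adj_def)
    then obtain e where e: "e \<in> edges G" "f ` ends G e = f ` {u, v}"
      using bg en unfolding bij_betw_def by (metis image_iff image_empty image_insert)
    then have "ends G e = {u, v}"
      using bf sub[OF e(1)] uv by (subst (asm) inj_on_image_eq_iff) (auto simp: bij_betw_def)
    then show "(u, v) \<in> adj G" using e by (auto simp: adj_def)
  next
    assume "(u, v) \<in> adj G"
    then obtain e where "e \<in> edges G" "ends G e = {u, v}" by (auto simp: adj_def)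
    then have "g e \<in> edges H" "ends H (g e) = {f u, f v}"
      using bg en by (auto simp: bij_betw_def)
    then show "(f u, f v) \<in> adj H" by (auto simp: adj_def)
  qed
  have pow: "(q, f v) \<in> adj H ^^ k \<longleftrightarrow> (p, v) \<in> adj G ^^ k" if "v \<in> verts G" for v k
    using that
  proof (induction k arbitrary: v)
    case 0
    then show ?case using bf iso(2) nets by (auto simp: bij_betw_def inj_on_def)
  next
    case (Suc k)
    show ?case
    proof
      assume "(q, f v) \<in> adj H ^^ Suc k"
      then obtain w where w: "(q, w) \<in> adj H ^^ k" "(w, f v) \<in> adj H" by auto
      then have "w \<in> verts H" using relpow_adj_in_verts nets by metis
      then obtain u where "u \<in> verts G" "w = f u" using bf unfolding bij_betw_def by blast
      then show "(p, v) \<in> adj G ^^ Suc k" using w Suc adj by auto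
    next
      assume "(p, v) \<in> adj G ^^ Suc k"
      then obtain u where u: "(p, u) \<in> adj G ^^ k" "(u, v) \<in> adj G" by auto
      then have "u \<in> verts G" using relpow_adj_in_verts nets by metis
      then show "(q, f v) \<in> adj H ^^ Suc k" using u Suc adj by auto
    qed
  qed
  have gd: "gdist H q (f v) = gdist G p v" if "v \<in> verts G" for v
    using pow[OF that] by (simp add: gdist_def)
  have sub': "ball_verts G p r \<subseteq> verts G" by (auto simp: ball_verts_def)
  have im: "f ` ball_verts G p r = ball_verts H q r"
  proof
    show "f ` ball_verts G p r \<subseteq> ball_verts H q r"
      using gd bf by (auto simp: ball_verts_def bij_betw_def)
    show "ball_verts H q r \<subseteq> f ` ball_verts G p r"
    proof
      fix w assume w: "w \<in> ball_verts H q r"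
      then obtain v where "v \<in> verts G" "w = f v"
        using bf unfolding ball_verts_def bij_betw_def by blast
      then show "w \<in> f ` ball_verts G p r" using w gd by (auto simp: ball_verts_def)
    qed
  qed
  have bf': "bij_betw f (ball_verts G p r) (ball_verts H q r)"
    using bf im sub' by (auto simp: bij_betw_def intro: inj_on_subset)
  have emem: "f ` ends G e \<subseteq> ball_verts H q r \<longleftrightarrow> ends G e \<subseteq> ball_verts G p r" if "e \<in> edges G" for e
    unfolding im[symmetric]
    using bf sub[OF that] sub' by (intro inj_on_image_subset_iff) (auto simp: bij_betw_def)
  have "g ` edges (graph_ball G p r) = edges (graph_ball H q r)"
  proof
    show "g ` edges (graph_ball G p r) \<subseteq> edges (graph_ball H q r)"
    proof
      fix h assume "h \<in> g ` edges (graph_ball G p r)"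
      then obtain e where "e \<in> edges G" "ends G e \<subseteq> ball_verts G p r" "h = g e" by auto
      then show "h \<in> edges (graph_ball H q r)" using emem en bg by (simp add: bij_betw_def) blast
    qed
    show "edges (graph_ball H q r) \<subseteq> g ` edges (graph_ball G p r)"
    proof
      fix h assume h: "h \<in> edges (graph_ball H q r)"
      then obtain e where "e \<in> edges G" "h = g e" using bg unfolding bij_betw_def by auto
      then show "h \<in> g ` edges (graph_ball G p r)" using h emem en by auto
    qed
  qed
  then have bg': "bij_betw g (edges (graph_ball G p r)) (edges (graph_ball H q r))"
    using bg by (auto simp: bij_betw_def intro: inj_on_subset)
  have "graph_iso f g (graph_ball G p r) (graph_ball H q r)"
    unfolding graph_iso_def using bf' bg' en by simp
  moreover have "marks_within \<epsilon> f g (graph_ball G p r) (graph_ball H q r)"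
    using iso \<epsilon> sub' by (auto simp: marks_within_def network_iso_def)
  ultimately show ?thesis using iso by (simp add: ball_iso_within_def)
qed

lemma rooted_class_in_nbhd_iff:
  fixes G :: "(nat, nat, 'm::metric_space) marked_graph"
  assumes G: "network G" "p \<in> verts G" and \<epsilon>: "0 < \<epsilon>" and H: "network H" "q \<in> verts H"
  shows "rooted_class H q \<in> rooted_nbhd r \<epsilon> G p \<longleftrightarrow> (\<exists>f g. ball_iso_within r \<epsilon> f g G p H q)"
proof
  assume "rooted_class H q \<in> rooted_nbhd r \<epsilon> G p"
  then obtain K k f g where K: "network K" "k \<in> verts K" "rooted_class H q = rooted_class K k"
    "ball_iso_within r \<epsilon> f g G p K k" by (rule rooted_nbhdE)
  obtain i j where ij: "network_iso i j K H" "i k = q"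
    using rooted_class_eq_iff[OF K(1,2) H, THEN iffD1, OF K(3)[symmetric]] by (elim exE conjE)
  obtain \<delta> where \<delta>: "0 < \<delta>" "\<And>f' g' (L :: (nat, nat, 'm) marked_graph) l.
      ball_iso_within r \<delta> f' g' K k L l \<Longrightarrow> ball_iso_within r \<epsilon> (f' \<circ> f) (g' \<circ> g) G p L l"
    by (rule ball_iso_within_comp[OF K(4) G \<epsilon>]) (rule that)
  show "\<exists>f g. ball_iso_within r \<epsilon> f g G p H q"
    by (intro exI, rule \<delta>(2), rule network_iso_ball_iso_within[OF ij \<delta>(1) K(1,2) H])
next
  assume "\<exists>f g. ball_iso_within r \<epsilon> f g G p H q"
  then show "rooted_class H q \<in> rooted_nbhd r \<epsilon> G p" by (elim exE) (rule rooted_nbhdI[OF H])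
qed

lemma birooted_class_in_nbhd_iff:
  fixes G :: "(nat, nat, 'm::metric_space) marked_graph"
  assumes G: "network G" "p \<in> verts G" and \<epsilon>: "0 < \<epsilon>"
    and H: "network H" "q \<in> verts H" "w \<in> verts H"
  shows "birooted_class H q w \<in> birooted_nbhd r \<epsilon> G p v \<longleftrightarrow>
    (\<exists>f g. ball_iso_within r \<epsilon> f g G p H q \<and> f v = w)"
proof
  assume "birooted_class H q w \<in> birooted_nbhd r \<epsilon> G p v"
  then obtain K k l f g where K: "network K" "k \<in> verts K" "l \<in> verts K"
    "birooted_class H q w = birooted_class K k l"
    "ball_iso_within r \<epsilon> f g G p K k" "f v = l" by (rule birooted_nbhdE)
  obtain i j where ij: "network_iso i j K H" "i k = q" "i l = w"
    using birooted_class_eq_iff[OF K(1,2,3) H, THEN iffD1, OF K(4)[symmetric]] by (elim exE conjE)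
  obtain \<delta> where \<delta>: "0 < \<delta>" "\<And>f' g' (L :: (nat, nat, 'm) marked_graph) l.
      ball_iso_within r \<delta> f' g' K k L l \<Longrightarrow> ball_iso_within r \<epsilon> (f' \<circ> f) (g' \<circ> g) G p L l"
    by (rule ball_iso_within_comp[OF K(5) G \<epsilon>]) (rule that)
  show "\<exists>f g. ball_iso_within r \<epsilon> f g G p H q \<and> f v = w"
  proof (intro exI conjI)
    show "ball_iso_within r \<epsilon> (i \<circ> f) (j \<circ> g) G p H q"
      by (rule \<delta>(2), rule network_iso_ball_iso_within[OF ij(1,2) \<delta>(1) K(1,2) H(1,2)])
    show "(i \<circ> f) v = w" by (simp add: K ij)
  qed
next
  assume "\<exists>f g. ball_iso_within r \<epsilon> f g G p H q \<and> f v = w"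
  then show "birooted_class H q w \<in> birooted_nbhd r \<epsilon> G p v" by (elim exE conjE) (rule birooted_nbhdI[OF H])
qed

lemma open_rooted_nbhd:
  fixes G :: "(nat, nat, 'm::metric_space) marked_graph"
  assumes G: "network G" "p \<in> verts G" and \<epsilon>: "0 < \<epsilon>"
  shows "open (rooted_nbhd r \<epsilon> G p)"
  unfolding open_rooted_net_def
proof (intro allI impI)
  fix H :: "(nat, nat, 'm) marked_graph" and q
  assume H: "network H \<and> q \<in> verts H \<and> rooted_class H q \<in> rooted_nbhd r \<epsilon> G p"
  obtain f g where *: "ball_iso_within r \<epsilon> f g G p H q"
    using H rooted_class_in_nbhd_iff[OF G \<epsilon>] by blast
  obtain \<delta> where \<delta>: "0 < \<delta>" "\<And>f' g' (K :: (nat, nat, 'm) marked_graph) k.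
      ball_iso_within r \<delta> f' g' H q K k \<Longrightarrow> ball_iso_within r \<epsilon> (f' \<circ> f) (g' \<circ> g) G p K k"
    by (rule ball_iso_within_comp[OF * G \<epsilon>]) (rule that)
  have "rooted_nbhd r \<delta> H q \<subseteq> rooted_nbhd r \<epsilon> G p"
  proof
    fix x assume "x \<in> rooted_nbhd r \<delta> H q"
    then obtain K k f' g' where K: "network K" "k \<in> verts K" "x = rooted_class K k"
      "ball_iso_within r \<delta> f' g' H q K k" by (rule rooted_nbhdE)
    show "x \<in> rooted_nbhd r \<epsilon> G p"
      unfolding K(3) by (rule rooted_nbhdI[OF K(1,2) \<delta>(2)[OF K(4)]])
  qed
  then show "\<exists>r'. \<exists>\<epsilon>'>0. rooted_nbhd r' \<epsilon>' H q \<subseteq> rooted_nbhd r \<epsilon> G p" using \<delta>(1) by blast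
qed

lemma open_birooted_nbhd:
  fixes G :: "(nat, nat, 'm::metric_space) marked_graph"
  assumes G: "network G" "p \<in> verts G" "v \<in> verts G" and r: "gdist G p v \<le> r" and \<epsilon>: "0 < \<epsilon>"
  shows "open (birooted_nbhd r \<epsilon> G p v)"
  unfolding open_birooted_net_def
proof (intro allI impI)
  fix H :: "(nat, nat, 'm) marked_graph" and q w
  assume H: "network H \<and> q \<in> verts H \<and> w \<in> verts H \<and>
    birooted_class H q w \<in> birooted_nbhd r \<epsilon> G p v"
  obtain f g where *: "ball_iso_within r \<epsilon> f g G p H q" "f v = w"
    using H birooted_class_in_nbhd_iff[OF G(1,2) \<epsilon>] by blast
  have "v \<in> ball_verts G p r" using G r by (simp add: ball_verts_def)
  then have "w \<in> ball_verts H q r"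
    using * by (auto simp: ball_iso_within_def graph_iso_def bij_betw_def)
  then have w: "gdist H q w \<le> r" by (simp add: ball_verts_def)
  obtain \<delta> where \<delta>: "0 < \<delta>" "\<And>f' g' (K :: (nat, nat, 'm) marked_graph) k.
      ball_iso_within r \<delta> f' g' H q K k \<Longrightarrow> ball_iso_within r \<epsilon> (f' \<circ> f) (g' \<circ> g) G p K k"
    by (rule ball_iso_within_comp[OF *(1) G(1,2) \<epsilon>]) (rule that)
  have "birooted_nbhd r \<delta> H q w \<subseteq> birooted_nbhd r \<epsilon> G p v"
  proof
    fix x assume "x \<in> birooted_nbhd r \<delta> H q w"
    then obtain K k l f' g' where K: "network K" "k \<in> verts K" "l \<in> verts K"
      "x = birooted_class K k l" "ball_iso_within r \<delta> f' g' H q K k" "f' w = l"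
      by (rule birooted_nbhdE)
    show "x \<in> birooted_nbhd r \<epsilon> G p v"
      unfolding K(4) by (rule birooted_nbhdI[OF K(1,2,3) \<delta>(2)[OF K(5)]]) (simp add: * K)
  qed
  then show "\<exists>r'\<ge>gdist H q w. \<exists>\<epsilon>'>0. birooted_nbhd r' \<epsilon>' H q w \<subseteq> birooted_nbhd r \<epsilon> G p v"
    using \<delta>(1) w by blast
qed

text \<open>The topologies have the convergence criterion that defines local convergence.\<close>

lemma rooted_tendsto_iff:
  fixes G :: "(nat, nat, 'm::metric_space) marked_graph"
  assumes G: "network G" "p \<in> verts G"
    and H: "\<And>n. network (H n)" "\<And>n. q n \<in> verts (H n)"
  shows "(\<lambda>n. rooted_class (H n) (q n)) \<longlonglongrightarrow> rooted_class G p \<longleftrightarrow>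
    (\<forall>r. \<forall>\<epsilon>>0. \<forall>\<^sub>F n in sequentially. \<exists>f g. ball_iso_within r \<epsilon> f g G p (H n) (q n))"
  (is "?lim \<longleftrightarrow> ?conv")
proof -
  have "?lim \<longleftrightarrow> (\<forall>r. \<forall>\<epsilon>>0. \<forall>\<^sub>F n in sequentially. rooted_class (H n) (q n) \<in> rooted_nbhd r \<epsilon> G p)"
    (is "_ \<longleftrightarrow> ?nb")
  proof
    assume ?lim
    show ?nb
    proof (intro allI impI)
      fix r and \<epsilon> :: real assume \<epsilon>: "0 < \<epsilon>"
      show "\<forall>\<^sub>F n in sequentially. rooted_class (H n) (q n) \<in> rooted_nbhd r \<epsilon> G p"
        by (rule topological_tendstoD[OF \<open>?lim\<close> open_rooted_nbhd[OF G \<epsilon>]])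
          (rule rooted_nbhdI[OF G ball_iso_within_refl[OF \<epsilon>]])
    qed
  next
    assume nb: ?nb
    show ?lim
    proof (rule topological_tendstoI)
      fix U assume "open U" "rooted_class G p \<in> U"
      then obtain r \<epsilon> where "0 < \<epsilon>" and U: "rooted_nbhd r \<epsilon> G p \<subseteq> U"
        using G unfolding open_rooted_net_def by blast
      then have "\<forall>\<^sub>F n in sequentially. rooted_class (H n) (q n) \<in> rooted_nbhd r \<epsilon> G p"
        using nb by blast
      then show "\<forall>\<^sub>F n in sequentially. rooted_class (H n) (q n) \<in> U"
        by (rule eventually_mono) (rule subsetD[OF U])
    qed
  qed
  then show ?thesis using rooted_class_in_nbhd_iff[OF G _ H] by simp
qed

lemma birooted_tendsto_iff:
  fixes G :: "(nat, nat, 'm::metric_space) marked_graph"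
  assumes G: "network G" "p \<in> verts G" "v \<in> verts G"
    and H: "\<And>n. network (H n)" "\<And>n. q n \<in> verts (H n)" "\<And>n. w n \<in> verts (H n)"
  shows "(\<lambda>n. birooted_class (H n) (q n) (w n)) \<longlonglongrightarrow> birooted_class G p v \<longleftrightarrow>
    (\<forall>r\<ge>gdist G p v. \<forall>\<epsilon>>0. \<forall>\<^sub>F n in sequentially.
       \<exists>f g. ball_iso_within r \<epsilon> f g G p (H n) (q n) \<and> f v = w n)"
  (is "?lim \<longleftrightarrow> ?conv")
proof -
  have "?lim \<longleftrightarrow> (\<forall>r\<ge>gdist G p v. \<forall>\<epsilon>>0. \<forall>\<^sub>F n in sequentially.
      birooted_class (H n) (q n) (w n) \<in> birooted_nbhd r \<epsilon> G p v)"
    (is "_ \<longleftrightarrow> ?nb")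
  proof
    assume ?lim
    show ?nb
    proof (intro allI impI)
      fix r and \<epsilon> :: real assume r: "gdist G p v \<le> r" and \<epsilon>: "0 < \<epsilon>"
      show "\<forall>\<^sub>F n in sequentially. birooted_class (H n) (q n) (w n) \<in> birooted_nbhd r \<epsilon> G p v"
        by (rule topological_tendstoD[OF \<open>?lim\<close> open_birooted_nbhd[OF G r \<epsilon>]])
          (rule birooted_nbhdI[OF G ball_iso_within_refl[OF \<epsilon>] id_apply])
    qed
  next
    assume nb: ?nb
    show ?lim
    proof (rule topological_tendstoI)
      fix U assume "open U" "birooted_class G p v \<in> U"
      then obtain r \<epsilon> where "gdist G p v \<le> r" "0 < \<epsilon>" and U: "birooted_nbhd r \<epsilon> G p v \<subseteq> U"
        using G unfolding open_birooted_net_def by blast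
      then have "\<forall>\<^sub>F n in sequentially.
          birooted_class (H n) (q n) (w n) \<in> birooted_nbhd r \<epsilon> G p v"
        using nb by blast
      then show "\<forall>\<^sub>F n in sequentially. birooted_class (H n) (q n) (w n) \<in> U"
        by (rule eventually_mono) (rule subsetD[OF U])
    qed
  qed
  then show ?thesis using birooted_class_in_nbhd_iff[OF G(1,2) _ H] by simp
qed

lemma network_has_nat_copy:
  fixes G :: "('v, 'e, 'm) marked_graph"
  assumes G: "network G"
  shows "\<exists>(H :: (nat, nat, 'm) marked_graph) f g. network H \<and> network_iso f g G H"
proof -
  obtain p where p: "p \<in> verts G" using G by (auto simp: network_def)
  have "verts G \<subseteq> (\<Union>r. ball_verts G p r)" by (auto simp: ball_verts_def)
  moreover have "countable (\<Union>r. ball_verts G p r)"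
    using finite_ball_verts[OF G p] by (intro countable_UN) (auto intro: countable_finite)
  ultimately have cv: "countable (verts G)" by (rule countable_subset)
  have "edges G \<subseteq> (\<Union>v\<in>verts G. {e \<in> edges G. v \<in> ends G e})"
  proof
    fix e assume e: "e \<in> edges G"
    then obtain v where "v \<in> ends G e" "v \<in> verts G" using network_ends[OF G] by blast
    then show "e \<in> (\<Union>v\<in>verts G. {e \<in> edges G. v \<in> ends G e})" using e by auto
  qed
  moreover have "countable \<dots>"
    using G by (intro countable_UN cv) (auto simp: network_def intro: countable_finite)
  ultimately have ce: "countable (edges G)" by (rule countable_subset)
  define f where "f = to_nat_on (verts G)"
  define g where "g = to_nat_on (edges G)"
  have f: "inj_on f (verts G)" and g: "inj_on g (edges G)"
    unfolding f_def g_def by (rule inj_on_to_nat_on[OF cv], rule inj_on_to_nat_on[OF ce])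
  define f' where "f' = inv_into (verts G) f"
  define g' where "g' = inv_into (edges G) g"
  have f': "f' (f v) = v" if "v \<in> verts G" for v using f that by (simp add: f'_def)
  have g': "g' (g e) = e" if "e \<in> edges G" for e using g that by (simp add: g'_def)
  define H :: "(nat, nat, 'm) marked_graph" where
    "H = \<lparr>verts = f ` verts G, edges = g ` edges G, ends = (\<lambda>h. f ` ends G (g' h)),
          vmark = (\<lambda>w. vmark G (f' w)), emark = (\<lambda>w h. emark G (f' w) (g' h))\<rparr>"
  have H: "verts H = f ` verts G" "edges H = g ` edges G" "\<And>h. ends H h = f ` ends G (g' h)"
    "\<And>w. vmark H w = vmark G (f' w)" "\<And>w h. emark H w h = emark G (f' w) (g' h)"
    by (simp_all add: H_def)
  have sub: "ends G e \<subseteq> verts G" "card (ends G e) \<in> {1, 2}" if "e \<in> edges G" for e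
    using G that by (auto simp: network_def)
  have iso: "network_iso f g G H"
    using f g sub by (auto simp: network_iso_def graph_iso_def H f' g' inj_on_imp_bij_betw subset_iff)
  have card: "card (f ` ends G e) = card (ends G e)" if "e \<in> edges G" for e
    using f sub[OF that] by (intro card_image) (rule inj_on_subset)
  have adj: "(f u, f v) \<in> adj H" if "(u, v) \<in> adj G" for u v
    using that by (auto simp: adj_def H g')
  have conn: "(f u, f v) \<in> (adj H)\<^sup>*" if "(u, v) \<in> (adj G)\<^sup>*" for u v
    using that
  proof (induction rule: rtrancl_induct)
    case (step y z)
    then show ?case using adj by (meson rtrancl.rtrancl_into_rtrancl)
  qed simp
  have fin: "finite {h \<in> edges H. w \<in> ends H h}" if w: "w \<in> verts H" for w
  proof -
    obtain v where v: "v \<in> verts G" "w = f v" using w by (auto simp: H)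
    have "{h \<in> edges H. w \<in> ends H h} \<subseteq> g ` {e \<in> edges G. v \<in> ends G e}"
    proof
      fix h assume "h \<in> {h \<in> edges H. w \<in> ends H h}"
      then obtain e u where e: "e \<in> edges G" "h = g e" "u \<in> ends G e" "f v = f u"
        using v by (auto simp: H g')
      then have "u = v" using inj_onD[OF f e(4)] v sub(1)[OF e(1)] by auto
      then show "h \<in> g ` {e \<in> edges G. v \<in> ends G e}" using e by auto
    qed
    moreover have "finite {e \<in> edges G. v \<in> ends G e}" using G v by (simp add: network_def)
    ultimately show ?thesis by (meson finite_imageI finite_subset)
  qed
  have "network H"
    unfolding network_def
  proof (intro conjI ballI)
    show "verts H \<noteq> {}" using p by (auto simp: H)
    show "ends H h \<subseteq> verts H" if "h \<in> edges H" for h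
      using that sub(1) by (fastforce simp: H g')
    show "card (ends H h) \<in> {1, 2}" if h: "h \<in> edges H" for h
    proof -
      obtain e where e: "e \<in> edges G" "h = g e" using h by (auto simp: H)
      then have "card (ends H h) = card (ends G e)" using card[OF e(1)] by (simp add: H g')
      then show ?thesis using sub(2)[OF e(1)] by simp
    qed
    show "(u, v) \<in> (adj H)\<^sup>*" if "u \<in> verts H" "v \<in> verts H" for u v
      using that conn G by (auto simp: H network_def)
  qed (use fin in auto)
  then show ?thesis using iso by blast
qed


section \<open>Unimodular networks\<close>

definition unimodular :: "'a measure \<Rightarrow> ('a \<Rightarrow> 'm::polish_space rooted_net) \<Rightarrow> bool" where
  "unimodular M X \<longleftrightarrow>
     (\<forall>g :: 'm birooted_net \<Rightarrow> real. g \<in> borel_measurable borel \<and> (\<forall>x. 0 \<le> g x) \<longrightarrow>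
       (\<integral>\<^sup>+ \<omega>. sum_from_root (\<lambda>x. ennreal (g x)) (X \<omega>) \<partial>M) =
       (\<integral>\<^sup>+ \<omega>. sum_to_root (\<lambda>x. ennreal (g x)) (X \<omega>) \<partial>M))"

definition unimodular_network :: "'a measure \<Rightarrow> ('a \<Rightarrow> 'm::polish_space rooted_net) \<Rightarrow> bool" where
  "unimodular_network M X \<longleftrightarrow> prob_space M \<and> X \<in> M \<rightarrow>\<^sub>M borel \<and> unimodular M X"

definition invariant_sets :: "'m::polish_space rooted_net set set" where
  "invariant_sets =
     {A \<in> sets borel. \<forall>G p v. network G \<and> p \<in> verts G \<and> v \<in> verts G \<and> rooted_class G p \<in> A \<longrightarrow>
        rooted_class G v \<in> A}"

definition strongly_unrooted_equiv ::
  "'a measure \<Rightarrow> ('a \<Rightarrow> 'm::polish_space rooted_net) \<Rightarrow> 'b measure \<Rightarrow> ('b \<Rightarrow> 'm rooted_net) \<Rightarrow> bool" where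
  "strongly_unrooted_equiv M\<^sub>1 X\<^sub>1 M\<^sub>2 X\<^sub>2 \<longleftrightarrow>
     (\<forall>A\<in>invariant_sets. measure M\<^sub>1 (X\<^sub>1 -` A \<inter> space M\<^sub>1) = measure M\<^sub>2 (X\<^sub>2 -` A \<inter> space M\<^sub>2))"

definition unrooted_algebra :: "'m::polish_space unrooted_net measure" where
  "unrooted_algebra = sigma UNIV {B. unroot -` B \<in> sets borel}"

lemma space_unrooted_algebra [simp]: "space unrooted_algebra = UNIV"
  by (simp add: unrooted_algebra_def)

lemma sets_unrooted_algebra:
  "sets (unrooted_algebra :: 'm::polish_space unrooted_net measure) = {B. unroot -` B \<in> sets borel}"
proof -
  have "sigma_algebra UNIV {B :: 'm unrooted_net set. unroot -` B \<in> sets borel}"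
    unfolding sigma_algebra_iff2
  proof (intro conjI ballI allI impI)
    fix B :: "'m unrooted_net set" assume "B \<in> {B. unroot -` B \<in> sets borel}"
    then have "UNIV - unroot -` B \<in> sets borel" by auto
    then show "UNIV - B \<in> {B. unroot -` B \<in> sets borel}" by (simp add: vimage_Diff)
  qed (auto simp: vimage_UN)
  then show ?thesis by (simp add: unrooted_algebra_def sigma_algebra.sigma_sets_eq)
qed

lemma measurable_unroot [measurable]: "unroot \<in> borel \<rightarrow>\<^sub>M unrooted_algebra"
  by (rule measurableI) (auto simp: sets_unrooted_algebra)

end

theory Submission
  imports Defs
begin

text \<open>
  Let \<open>P\<close> and \<open>Q\<close> be the laws of two unimodular networks that agree on invariant sets. A Hahn
  decomposition gives a measurable set \<open>A\<close> such that \<open>Q \<le> P\<close> on every part of \<open>A\<close> and \<open>P \<le> Q\<close> on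
  every part of the complement. It suffices to show \<open>P C = Q C\<close> for measurable \<open>C \<subseteq> A\<close>, because the
  parts of the complement are the same situation with \<open>P\<close> and \<open>Q\<close> exchanged. Split \<open>C\<close> according
  to whether some vertex of the network, taken as the root, leaves \<open>A\<close>.

  If there is such a vertex within distance \<open>k\<close>, let the root send mass one, in equal shares, to the
  vertices of this kind within distance \<open>k\<close>. By unimodularity the \<open>P\<close>-measure of this part of \<open>C\<close>,
  which is the expected mass sent, equals the expected mass received under \<open>P\<close>. All of it is
  received outside \<open>A\<close>, where \<open>P \<le> Q\<close>; so it is at most the expected mass received under \<open>Q\<close>, which
  is the \<open>Q\<close>-measure of the same part of \<open>C\<close>. The part lies in \<open>A\<close>, where \<open>Q \<le> P\<close>, and equality
  follows (\<open>transport_to_complement\<close>); then let \<open>k\<close> tend to infinity.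

  If there is no such vertex, the network lies in the invariant set \<open>I\<close> of those networks that are in
  \<open>A\<close> for every choice of the root. There \<open>P I = Q I\<close>, and \<open>Q \<le> P\<close> on both \<open>C \<inter> I\<close> and \<open>I - C\<close>, so
  neither inequality can be strict (\<open>emeasure_eq_on_Hahn_set\<close>).

  The remaining work is measurability. Exchanging the two roots is continuous, since an isomorphism
  of large balls about one root restricts to smaller balls about the other
  (\<open>ball_iso_within_recentre\<close>). The number of vertices \<open>v\<close> near the root for which the doubly rooted
  network lies in an open set is lower semicontinuous (\<open>open_sum_from_root_greater\<close>), and a monotone
  class argument extends measurability to the sums of arbitrary measurable functions
  (\<open>measurable_sum_from_root\<close>). Finally, the invariant sets are exactly the preimages of the
  measurable sets of unrooted networks; so agreement on invariant sets means equality of the laws of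
  the unrooted networks.
\<close>

section \<open>Roots of doubly rooted networks\<close>

lemma rooted_net_cases:
  obtains G p where "network G" "p \<in> verts G" "x = rooted_class G p"
proof -
  have "rooted_iso (rep_rooted_net x) (rep_rooted_net x)"
    by (rule Quotient3_rep_reflp[OF Quotient3_rooted_net])
  moreover have "x = abs_rooted_net (rep_rooted_net x)"
    by (rule Quotient3_abs_rep[OF Quotient3_rooted_net, symmetric])
  moreover obtain G p where "rep_rooted_net x = (G, p)" by (rule prod.exhaust)
  ultimately have "network G" "p \<in> verts G" "x = rooted_class G p"
    by (simp_all add: rooted_iso_def)
  then show thesis by (rule that)
qed

lemma birooted_net_cases:
  obtains G p v where "network G" "p \<in> verts G" "v \<in> verts G" "x = birooted_class G p v"
proof -
  have "birooted_iso (rep_birooted_net x) (rep_birooted_net x)"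
    by (rule Quotient3_rep_reflp[OF Quotient3_birooted_net])
  moreover have "x = abs_birooted_net (rep_birooted_net x)"
    by (rule Quotient3_abs_rep[OF Quotient3_birooted_net, symmetric])
  moreover obtain G p v where "rep_birooted_net x = (G, p, v)" by (rule prod_cases3)
  ultimately have "network G" "p \<in> verts G" "v \<in> verts G" "x = birooted_class G p v"
    by (simp_all add: birooted_iso_def)
  then show thesis by (rule that)
qed

lemma rooted_iso_refl: "network G \<Longrightarrow> p \<in> verts G \<Longrightarrow> rooted_iso (G, p) (G, p)"
  using network_iso_id by (auto simp: rooted_iso_def intro!: exI[of _ id])

lemma birooted_iso_refl:
  "network G \<Longrightarrow> p \<in> verts G \<Longrightarrow> v \<in> verts G \<Longrightarrow> birooted_iso (G, p, v) (G, p, v)"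
  using network_iso_id by (auto simp: birooted_iso_def intro!: exI[of _ id])

lift_definition first_root :: "'m birooted_net \<Rightarrow> 'm rooted_net" is "\<lambda>(G, p, v). (G, p)"
  unfolding rooted_iso_def birooted_iso_def by auto

lift_definition swap_roots :: "'m birooted_net \<Rightarrow> 'm birooted_net" is "\<lambda>(G, p, v). (G, v, p)"
  unfolding birooted_iso_def by auto

definition second_root :: "'m birooted_net \<Rightarrow> 'm rooted_net" where
  "second_root x = first_root (swap_roots x)"

lemma first_root_class [simp]:
  "network G \<Longrightarrow> p \<in> verts G \<Longrightarrow> v \<in> verts G \<Longrightarrow>
   first_root (birooted_class G p v) = rooted_class G p"
  by (simp add: first_root.abs_eq birooted_iso_refl)

lemma swap_roots_class [simp]:
  "network G \<Longrightarrow> p \<in> verts G \<Longrightarrow> v \<in> verts G \<Longrightarrow>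
   swap_roots (birooted_class G p v) = birooted_class G v p"
  by (simp add: swap_roots.abs_eq birooted_iso_refl)

lemma second_root_class [simp]:
  "network G \<Longrightarrow> p \<in> verts G \<Longrightarrow> v \<in> verts G \<Longrightarrow>
   second_root (birooted_class G p v) = rooted_class G v"
  by (simp add: second_root_def)

lemma sum_from_root_class:
  "network G \<Longrightarrow> p \<in> verts G \<Longrightarrow>
   sum_from_root g (rooted_class G p) =
     (\<integral>\<^sup>+ v. g (birooted_class G p v) \<partial>count_space (verts G))"
  by (simp add: sum_from_root.abs_eq rooted_iso_refl)

text \<open>
  Exchanging the roots reduces the mass received to a mass sent, so that every property of
  \<open>sum_from_root\<close> carries over to \<open>sum_to_root\<close>.
\<close>

lemma sum_to_root_eq: "sum_to_root g x = sum_from_root (\<lambda>y. g (swap_roots y)) x"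
proof (cases x rule: rooted_net_cases)
  case (1 G p)
  have "sum_to_root g x = (\<integral>\<^sup>+ v. g (birooted_class G v p) \<partial>count_space (verts G))"
    using 1 by (simp add: sum_to_root.abs_eq rooted_iso_refl)
  also have "\<dots> = (\<integral>\<^sup>+ v. g (swap_roots (birooted_class G p v)) \<partial>count_space (verts G))"
    using 1 by (intro nn_integral_cong) simp
  finally show ?thesis using 1 by (simp add: sum_from_root_class)
qed

section \<open>Moving the centre of a ball isomorphism\<close>

lemma gdist_triangle_relpow:
  assumes "network G" "p \<in> verts G" "v \<in> verts G" "(v, u) \<in> adj G ^^ k"
  shows "gdist G p u \<le> gdist G p v + k"
  using gdist_relpow[OF assms(1-3)] assms(4) by (intro gdist_le) (auto simp: relpow_add)

text \<open>
  A walk of length \<open>k\<close> from \<open>v\<close> stays within distance \<open>gdist G p v + k\<close> of \<open>p\<close>; hence all of its edges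
  lie in the ball about \<open>p\<close> on which the isomorphism acts.
\<close>

lemma ball_graph_iso_relpow:
  assumes iso: "graph_iso f g (graph_ball G p R) (graph_ball H q R)"
    and G: "network G" "p \<in> verts G" "v \<in> verts G"
    and path: "(v, u) \<in> adj G ^^ k" and k: "gdist G p v + k \<le> R"
  shows "(f v, f u) \<in> adj H ^^ k"
  using path k
proof (induction k arbitrary: u)
  case (Suc k)
  then obtain w where w: "(v, w) \<in> adj G ^^ k" "(w, u) \<in> adj G" by auto
  then obtain e where e: "e \<in> edges G" "ends G e = {w, u}" by (auto simp: adj_def)
  have "w \<in> verts G" "u \<in> verts G"
    using relpow_adj_in_verts[OF G(1) _ G(3)] w(1) Suc.prems(1) by blast+
  moreover have "gdist G p w \<le> R" "gdist G p u \<le> R"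
    using gdist_triangle_relpow[OF G w(1)] gdist_triangle_relpow[OF G Suc.prems(1)] Suc.prems(2)
    by linarith+
  ultimately have "e \<in> edges (graph_ball G p R)" using e by (simp add: ball_verts_def)
  then have "g e \<in> edges (graph_ball H q R)" "ends H (g e) = f ` {w, u}"
    using iso e by (auto simp: graph_iso_def bij_betw_def)
  then have "(f w, f u) \<in> adj H" by (auto simp: adj_def)
  moreover have "(f v, f w) \<in> adj H ^^ k" using Suc w by simp
  ultimately show ?case by auto
qed simp

text \<open>
  The ball of radius \<open>r\<close> about \<open>v\<close> is contained in the ball of radius \<open>gdist G p v + r\<close> about \<open>p\<close>,
  and so are the walks that determine it. Transferring these walks in both directions shows that \<open>f\<close>
  maps the small ball about \<open>v\<close> exactly onto the small ball about \<open>f v\<close>.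
\<close>

lemma ball_iso_within_recentre:
  assumes *: "ball_iso_within R \<epsilon> f g G p H q"
    and nets: "network G" "p \<in> verts G" "network H" "q \<in> verts H"
    and v: "v \<in> verts G" and r: "gdist G p v + r \<le> R"
  shows "ball_iso_within r \<epsilon> f g G v H (f v)"
proof -
  have iso: "graph_iso f g (graph_ball G p R) (graph_ball H q R)" and fp: "f p = q"
    and m: "marks_within \<epsilon> f g (graph_ball G p R) (graph_ball H q R)"
    using * by (auto simp: ball_iso_within_def)
  have bf: "bij_betw f (ball_verts G p R) (ball_verts H q R)"
    and bg: "bij_betw g (edges (graph_ball G p R)) (edges (graph_ball H q R))"
    and en: "\<And>e. e \<in> edges (graph_ball G p R) \<Longrightarrow> ends H (g e) = f ` ends G e"
    using iso by (auto simp: graph_iso_def)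
  have vR: "v \<in> ball_verts G p R" using v r by (simp add: ball_verts_def)
  then have fvR: "f v \<in> ball_verts H q R" using bf by (auto simp: bij_betw_def)
  then have fv: "f v \<in> verts H" by (simp add: ball_verts_def)
  have d: "gdist H q (f v) = gdist G p v"
    using graph_iso_ball_gdist[of f g G p R H v] iso fp nets vR by simp
  let ?f = "inv_into (verts (graph_ball G p R)) f"
  let ?g = "inv_into (edges (graph_ball G p R)) g"
  have fi: "?f (f u) = u" if "u \<in> ball_verts G p R" for u
    using bf that by (simp add: bij_betw_inv_into_left)
  have iso': "graph_iso ?f ?g (graph_ball H q R) (graph_ball G p R)"
    by (rule graph_iso_inv[OF iso]) simp
  have sub: "ball_verts G v r \<subseteq> ball_verts G p R"
  proof
    fix u assume u: "u \<in> ball_verts G v r"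
    then have "(v, u) \<in> adj G ^^ gdist G v u"
      using gdist_relpow nets v by (auto simp: ball_verts_def)
    then show "u \<in> ball_verts G p R"
      using gdist_triangle_relpow[OF nets(1,2) v, of u "gdist G v u"] u r
      by (auto simp: ball_verts_def)
  qed
  have subH: "ball_verts H (f v) r \<subseteq> ball_verts H q R"
  proof
    fix u assume u: "u \<in> ball_verts H (f v) r"
    then have "(f v, u) \<in> adj H ^^ gdist H (f v) u"
      using gdist_relpow nets fv by (auto simp: ball_verts_def)
    then show "u \<in> ball_verts H q R"
      using gdist_triangle_relpow[OF nets(3,4) fv, of u "gdist H (f v) u"] u r d
      by (auto simp: ball_verts_def)
  qed
  have mem: "f u \<in> ball_verts H (f v) r \<longleftrightarrow> u \<in> ball_verts G v r"
    if u: "u \<in> ball_verts G p R" for u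
  proof
    have uG: "u \<in> verts G" and uH: "f u \<in> verts H"
      using u bf by (auto simp: ball_verts_def bij_betw_def)
    show "f u \<in> ball_verts H (f v) r" if "u \<in> ball_verts G v r"
    proof -
      have le: "gdist G v u \<le> r" using that by (simp add: ball_verts_def)
      have "(f v, f u) \<in> adj H ^^ gdist G v u"
        using le r
        by (intro ball_graph_iso_relpow[OF iso nets(1,2) v gdist_relpow[OF nets(1) v uG]]) simp
      then show ?thesis using gdist_le le uH by (fastforce simp: ball_verts_def)
    qed
    show "u \<in> ball_verts G v r" if "f u \<in> ball_verts H (f v) r"
    proof -
      have le: "gdist H (f v) (f u) \<le> r" using that by (simp add: ball_verts_def)
      have "(?f (f v), ?f (f u)) \<in> adj G ^^ gdist H (f v) (f u)"
        using le r d
        by (intro ball_graph_iso_relpow[OF iso' nets(3,4) fv gdist_relpow[OF nets(3) fv uH]]) simp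
      then show ?thesis using gdist_le le uG fi[OF u] fi[OF vR] by (fastforce simp: ball_verts_def)
    qed
  qed
  have "f ` ball_verts G v r = ball_verts H (f v) r"
  proof
    show "f ` ball_verts G v r \<subseteq> ball_verts H (f v) r" using mem sub by auto
    show "ball_verts H (f v) r \<subseteq> f ` ball_verts G v r"
    proof
      fix w assume w: "w \<in> ball_verts H (f v) r"
      then obtain u where "u \<in> ball_verts G p R" "w = f u"
        using bf subH unfolding bij_betw_def by blast
      then show "w \<in> f ` ball_verts G v r" using mem w by auto
    qed
  qed
  then have bf': "bij_betw f (ball_verts G v r) (ball_verts H (f v) r)"
    using bf sub by (auto simp: bij_betw_def intro: inj_on_subset)
  have esub: "edges (graph_ball G v r) \<subseteq> edges (graph_ball G p R)"
    "edges (graph_ball H (f v) r) \<subseteq> edges (graph_ball H q R)"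
    using sub subH by auto
  have emem: "g e \<in> edges (graph_ball H (f v) r) \<longleftrightarrow> e \<in> edges (graph_ball G v r)"
    if "e \<in> edges (graph_ball G p R)" for e
  proof -
    have "g e \<in> edges (graph_ball H q R)" using bg that by (auto simp: bij_betw_def)
    moreover have "f ` ends G e \<subseteq> ball_verts H (f v) r \<longleftrightarrow> ends G e \<subseteq> ball_verts G v r"
      using that mem by auto
    ultimately show ?thesis using that en[OF that] by auto
  qed
  have "g ` edges (graph_ball G v r) = edges (graph_ball H (f v) r)"
  proof
    show "g ` edges (graph_ball G v r) \<subseteq> edges (graph_ball H (f v) r)"
      using emem esub by blast
    show "edges (graph_ball H (f v) r) \<subseteq> g ` edges (graph_ball G v r)"
    proof
      fix h assume h: "h \<in> edges (graph_ball H (f v) r)"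
      then obtain e where "e \<in> edges (graph_ball G p R)" "h = g e"
        using bg esub unfolding bij_betw_def by blast
      then show "h \<in> g ` edges (graph_ball G v r)" using emem h by blast
    qed
  qed
  then have bg': "bij_betw g (edges (graph_ball G v r)) (edges (graph_ball H (f v) r))"
    using bg esub unfolding bij_betw_def by (blast intro: inj_on_subset)
  have "graph_iso f g (graph_ball G v r) (graph_ball H (f v) r)"
    unfolding graph_iso_def using bf' bg' en esub by auto
  moreover have "marks_within \<epsilon> f g (graph_ball G v r) (graph_ball H (f v) r)"
    using m sub unfolding marks_within_def by (simp add: subset_iff)
  ultimately show ?thesis by (simp add: ball_iso_within_def)
qed

lemma open_vimage_first_root:
  fixes U :: "'m::metric_space rooted_net set"
  assumes "open U"
  shows "open (first_root -` U)"
  unfolding open_birooted_net_def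
proof (intro allI impI)
  fix G :: "(nat, nat, 'm) marked_graph" and p v
  assume G: "network G \<and> p \<in> verts G \<and> v \<in> verts G \<and> birooted_class G p v \<in> first_root -` U"
  then obtain r \<epsilon> where \<epsilon>: "0 < \<epsilon>" "rooted_nbhd r \<epsilon> G p \<subseteq> U"
    using assms unfolding open_rooted_net_def by (metis vimageE first_root_class)
  let ?R = "max r (gdist G p v)"
  have "birooted_nbhd ?R \<epsilon> G p v \<subseteq> first_root -` U"
  proof
    fix x assume "x \<in> birooted_nbhd ?R \<epsilon> G p v"
    then obtain H q w f g where H: "network H" "q \<in> verts H" "w \<in> verts H"
      "x = birooted_class H q w" "ball_iso_within ?R \<epsilon> f g G p H q" by (rule birooted_nbhdE)
    have "rooted_class H q \<in> rooted_nbhd r \<epsilon> G p"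
      using G H by (intro rooted_nbhdI[OF H(1,2) ball_iso_within_restrict[OF H(5)]]) auto
    then show "x \<in> first_root -` U" using H \<epsilon> by auto
  qed
  then show "\<exists>r\<ge>gdist G p v. \<exists>\<epsilon>>0. birooted_nbhd r \<epsilon> G p v \<subseteq> first_root -` U"
    using \<epsilon>(1) by (intro exI[of _ ?R]) auto
qed

text \<open>
  A neighbourhood of radius \<open>r\<close> about the second root is controlled by one of radius
  \<open>gdist G p v + r\<close> about the first root.
\<close>

lemma open_vimage_swap_roots:
  fixes U :: "'m::metric_space birooted_net set"
  assumes "open U"
  shows "open (swap_roots -` U)"
  unfolding open_birooted_net_def
proof (intro allI impI)
  fix G :: "(nat, nat, 'm) marked_graph" and p v
  assume G: "network G \<and> p \<in> verts G \<and> v \<in> verts G \<and> birooted_class G p v \<in> swap_roots -` U"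
  then obtain r \<epsilon> where \<epsilon>: "0 < \<epsilon>" "birooted_nbhd r \<epsilon> G v p \<subseteq> U"
    using assms unfolding open_birooted_net_def by (metis vimageE swap_roots_class)
  let ?R = "gdist G p v + r"
  have "birooted_nbhd ?R \<epsilon> G p v \<subseteq> swap_roots -` U"
  proof
    fix x assume "x \<in> birooted_nbhd ?R \<epsilon> G p v"
    then obtain H q w f g where H: "network H" "q \<in> verts H" "w \<in> verts H"
      "x = birooted_class H q w" "ball_iso_within ?R \<epsilon> f g G p H q" "f v = w"
      by (rule birooted_nbhdE)
    have "f p = q" using H(5) by (simp add: ball_iso_within_def)
    moreover have "ball_iso_within r \<epsilon> f g G v H w"
      using ball_iso_within_recentre[OF H(5) _ _ H(1,2), of v r] G H(6) by simp
    ultimately have "birooted_class H w q \<in> birooted_nbhd r \<epsilon> G v p"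
      by (intro birooted_nbhdI[OF H(1,3,2)])
    then show "x \<in> swap_roots -` U" using H \<epsilon> by auto
  qed
  then show "\<exists>r\<ge>gdist G p v. \<exists>\<epsilon>>0. birooted_nbhd r \<epsilon> G p v \<subseteq> swap_roots -` U"
    using \<epsilon>(1) by (intro exI[of _ ?R]) auto
qed

lemma measurable_first_root [measurable]:
  "(first_root :: 'm::metric_space birooted_net \<Rightarrow> _) \<in> borel \<rightarrow>\<^sub>M borel"
  by (rule borel_measurableI) (simp add: open_vimage_first_root borel_open)

lemma measurable_swap_roots [measurable]:
  "(swap_roots :: 'm::metric_space birooted_net \<Rightarrow> _) \<in> borel \<rightarrow>\<^sub>M borel"
  by (rule borel_measurableI) (simp add: open_vimage_swap_roots borel_open)

lemma measurable_second_root [measurable]: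
  "(second_root :: 'm::metric_space birooted_net \<Rightarrow> _) \<in> borel \<rightarrow>\<^sub>M borel"
  unfolding second_root_def[abs_def] by measurable

section \<open>Measurability of sums over the vertices\<close>

text \<open>
  This is the set of doubly rooted networks whose roots are at distance at most \<open>k\<close>
  (\<open>class_in_roots_within_iff\<close>). As a union of basic neighbourhoods it is open by construction.
  Within it the vertex sums of indicators are finite, so that differences of them make sense.
\<close>

definition roots_within :: "nat \<Rightarrow> 'm::metric_space birooted_net set" where
  "roots_within k =
     (\<Union>(G, p, v) \<in> {(G, p, v). network G \<and> p \<in> verts G \<and> v \<in> verts G \<and> gdist G p v \<le> k}.
        birooted_nbhd k 1 G p v)"

lemma open_roots_within: "open (roots_within k :: 'm::metric_space birooted_net set)"
  unfolding roots_within_def by (rule open_UN) (auto intro: open_birooted_nbhd)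

lemma class_in_roots_within_iff:
  fixes H :: "(nat, nat, 'm::metric_space) marked_graph"
  assumes H: "network H" "q \<in> verts H" "w \<in> verts H"
  shows "birooted_class H q w \<in> roots_within k \<longleftrightarrow> gdist H q w \<le> k"
proof
  assume "gdist H q w \<le> k"
  moreover have "birooted_class H q w \<in> birooted_nbhd k 1 H q w"
    by (rule birooted_nbhdI[OF H ball_iso_within_refl]) simp_all
  ultimately show "birooted_class H q w \<in> roots_within k"
    using H unfolding roots_within_def by blast
next
  assume "birooted_class H q w \<in> roots_within k"
  then obtain G :: "(nat, nat, 'm) marked_graph" and p v where
    G: "network G" "p \<in> verts G" "v \<in> verts G" "gdist G p v \<le> k"
    and nb: "birooted_class H q w \<in> birooted_nbhd k 1 G p v"
    by (auto simp: roots_within_def)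
  obtain f g where "ball_iso_within k 1 f g G p H q" "f v = w"
    using nb birooted_class_in_nbhd_iff[OF G(1,2) _ H] by auto
  then have "bij_betw f (ball_verts G p k) (ball_verts H q k)" "f v = w"
    by (auto simp: ball_iso_within_def graph_iso_def)
  moreover have "v \<in> ball_verts G p k" using G by (simp add: ball_verts_def)
  ultimately have "w \<in> ball_verts H q k" by (auto simp: bij_betw_def)
  then show "gdist H q w \<le> k" by (simp add: ball_verts_def)
qed

lemma sum_from_root_indicator:
  assumes "network G" "p \<in> verts G"
  shows "sum_from_root (indicator B) (rooted_class G p) =
    emeasure (count_space UNIV) {v \<in> verts G. birooted_class G p v \<in> B}"
proof -
  have "sum_from_root (indicator B) (rooted_class G p) =
      (\<integral>\<^sup>+ v. indicator {v \<in> verts G. birooted_class G p v \<in> B} v \<partial>count_space (verts G))"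
    unfolding sum_from_root_class[OF assms]
    by (rule nn_integral_cong) (auto simp: indicator_def)
  also have "\<dots> = emeasure (count_space (verts G)) {v \<in> verts G. birooted_class G p v \<in> B}"
    by (rule nn_integral_indicator) simp
  finally show ?thesis by (simp add: emeasure_count_space)
qed

lemma finite_class_in_roots_within:
  fixes G :: "(nat, nat, 'm::metric_space) marked_graph"
  assumes "network G" "p \<in> verts G"
  shows "finite {v \<in> verts G. birooted_class G p v \<in> B \<inter> roots_within k}"
proof (rule finite_subset[OF _ finite_ball_verts[OF assms, of k]])
  show "{v \<in> verts G. birooted_class G p v \<in> B \<inter> roots_within k} \<subseteq> ball_verts G p k"
    using assms by (auto simp: ball_verts_def class_in_roots_within_iff)
qed

lemma sum_from_root_indicator_finite:
  "sum_from_root (indicator (B \<inter> roots_within k)) x < \<top>"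
proof (cases x rule: rooted_net_cases)
  case (1 G p)
  then show ?thesis using finite_class_in_roots_within[OF 1(1,2), of B k]
    by (simp add: sum_from_root_indicator less_top[symmetric])
qed

text \<open>
  Lower semicontinuity of the count: only finitely many vertices within distance \<open>k\<close> are counted at
  \<open>(G, p)\<close>, so a single neighbourhood of \<open>(G, p)\<close> is small enough to transport all of them, and
  injectively, to vertices that are counted in any network of the neighbourhood.
\<close>

lemma open_sum_from_root_greater:
  fixes B :: "'m::metric_space birooted_net set"
  assumes "open B"
  shows "open {x. a < sum_from_root (indicator (B \<inter> roots_within k)) x}"
  unfolding open_rooted_net_def
proof (intro allI impI)
  let ?B = "B \<inter> roots_within k :: 'm birooted_net set"
  fix G :: "(nat, nat, 'm) marked_graph" and p
  assume "network G \<and> p \<in> verts G \<and> rooted_class G p \<in> {x. a < sum_from_root (indicator ?B) x}"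
  then have G: "network G" "p \<in> verts G" and a: "a < sum_from_root (indicator ?B) (rooted_class G p)"
    by auto
  define F where "F = {v \<in> verts G. birooted_class G p v \<in> ?B}"
  have fin: "finite F" unfolding F_def by (rule finite_class_in_roots_within[OF G])
  have "\<exists>r \<epsilon>. gdist G p v \<le> r \<and> 0 < \<epsilon> \<and> birooted_nbhd r \<epsilon> G p v \<subseteq> ?B" if "v \<in> F" for v
    using open_Int[OF assms open_roots_within[of k]] that G
    unfolding open_birooted_net_def F_def by blast
  then obtain \<rho> \<eta> where \<rho>: "\<And>v. v \<in> F \<Longrightarrow> 0 < \<eta> v"
    "\<And>v. v \<in> F \<Longrightarrow> birooted_nbhd (\<rho> v) (\<eta> v) G p v \<subseteq> ?B" "\<And>v. v \<in> F \<Longrightarrow> gdist G p v \<le> \<rho> v"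
    by metis
  define r where "r = Max (insert 0 (\<rho> ` F))"
  define \<epsilon> where "\<epsilon> = Min (insert 1 (\<eta> ` F))"
  have r: "\<rho> v \<le> r" if "v \<in> F" for v using that fin by (auto simp: r_def)
  have \<epsilon>: "\<epsilon> \<le> \<eta> v" if "v \<in> F" for v using that fin by (auto simp: \<epsilon>_def)
  have \<epsilon>0: "0 < \<epsilon>" using fin \<rho>(1) by (auto simp: \<epsilon>_def)
  have "rooted_nbhd r \<epsilon> G p \<subseteq> {x. a < sum_from_root (indicator ?B) x}"
  proof
    fix x assume "x \<in> rooted_nbhd r \<epsilon> G p"
    then obtain H q f g where H: "network H" "q \<in> verts H" "x = rooted_class H q"
      and iso: "ball_iso_within r \<epsilon> f g G p H q" by (rule rooted_nbhdE)
    have bij: "bij_betw f (ball_verts G p r) (ball_verts H q r)"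
      using iso by (simp add: ball_iso_within_def graph_iso_def)
    have FB: "F \<subseteq> ball_verts G p r"
      using \<rho>(3) r by (fastforce simp: F_def ball_verts_def)
    have sub: "f ` F \<subseteq> {w \<in> verts H. birooted_class H q w \<in> ?B}"
    proof
      fix w assume "w \<in> f ` F"
      then obtain v where v: "v \<in> F" "w = f v" by auto
      have w: "w \<in> verts H" using v bij FB by (auto simp: bij_betw_def ball_verts_def)
      have "birooted_class H q w \<in> birooted_nbhd r \<epsilon> G p v"
        by (rule birooted_nbhdI[OF H(1,2) w iso]) (simp add: v)
      then show "w \<in> {w \<in> verts H. birooted_class H q w \<in> ?B}"
        using birooted_nbhd_mono[OF G r[OF v(1)] \<epsilon>[OF v(1)], of v] \<rho>(2)[OF v(1)] w by blast
    qed
    have "inj_on f F" using bij FB by (auto simp: bij_betw_def intro: inj_on_subset)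
    then have "emeasure (count_space UNIV) F = emeasure (count_space UNIV) (f ` F)"
      using fin by (simp add: card_image)
    also have "\<dots> \<le> sum_from_root (indicator ?B) x"
      unfolding H(3) sum_from_root_indicator[OF H(1,2)] by (rule emeasure_mono[OF sub]) simp
    finally show "x \<in> {x. a < sum_from_root (indicator ?B) x}"
      using a G by (simp add: sum_from_root_indicator F_def)
  qed
  then show "\<exists>r. \<exists>\<epsilon>>0. rooted_nbhd r \<epsilon> G p \<subseteq> {x. a < sum_from_root (indicator ?B) x}"
    using \<epsilon>0 by blast
qed

lemma sum_from_root_add:
  "sum_from_root (\<lambda>y. g y + h y) x = sum_from_root g x + sum_from_root h x"
  by (cases x rule: rooted_net_cases) (simp add: sum_from_root_class nn_integral_add)

lemma sum_from_root_cmult: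
  "sum_from_root (\<lambda>y. c * g y) x = c * sum_from_root g x"
  by (cases x rule: rooted_net_cases) (simp add: sum_from_root_class nn_integral_cmult)

lemma sum_from_root_SUP:
  assumes "incseq g"
  shows "sum_from_root (\<lambda>y. SUP i. g i y) x = (SUP i. sum_from_root (g i) x)"
proof (cases x rule: rooted_net_cases)
  case (1 G p)
  have "incseq (\<lambda>i v. g i (birooted_class G p v))"
    using assms by (auto simp: incseq_def le_fun_def)
  then show ?thesis
    using 1 by (simp add: sum_from_root_class nn_integral_monotone_convergence_SUP)
qed

lemma sum_from_root_suminf:
  "sum_from_root (\<lambda>y. \<Sum>i. g i y) x = (\<Sum>i. sum_from_root (g i) x)"
  by (cases x rule: rooted_net_cases) (simp add: sum_from_root_class nn_integral_suminf)

text \<open>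
  The sets \<open>B\<close> with this property form a Dynkin system that contains the open sets; closure under
  complements uses that the counts are finite.
\<close>

lemma measurable_sum_from_root_indicator_within:
  fixes B :: "'m::metric_space birooted_net set"
  assumes "B \<in> sets borel"
  shows "sum_from_root (indicator (B \<inter> roots_within k)) \<in> borel_measurable borel"
proof -
  have B: "B \<in> sigma_sets UNIV {U :: 'm birooted_net set. open U}"
    using assms by (simp add: borel_def)
  have base: "sum_from_root (indicator (U \<inter> roots_within k)) \<in> borel_measurable borel"
    if "open U" for U :: "'m birooted_net set"
    by (rule borel_measurableI_greater) (simp add: open_sum_from_root_greater[OF that] borel_open)
  show ?thesis
  proof (rule sigma_sets_induct_disjoint[OF _ _ B])
    show "sum_from_root (indicator ({} \<inter> roots_within k :: 'm birooted_net set)) \<in> borel_measurable borel"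
      by (rule base[OF open_empty])
    show "Int_stable {U :: 'm birooted_net set. open U}" by (auto simp: Int_stable_def)
    fix A :: "'m birooted_net set"
    assume A: "sum_from_root (indicator (A \<inter> roots_within k)) \<in> borel_measurable borel"
    have eq: "sum_from_root (indicator ((UNIV - A) \<inter> roots_within k)) x =
        sum_from_root (indicator (UNIV \<inter> roots_within k)) x -
        sum_from_root (indicator (A \<inter> roots_within k)) x" for x :: "'m rooted_net"
    proof -
      have "sum_from_root (indicator (UNIV \<inter> roots_within k)) x =
          sum_from_root (\<lambda>y. indicator ((UNIV - A) \<inter> roots_within k) y +
            indicator (A \<inter> roots_within k) y) x"
        by (rule arg_cong[where f = "\<lambda>h. sum_from_root h x"]) (auto simp: indicator_def)
      also have "\<dots> = sum_from_root (indicator ((UNIV - A) \<inter> roots_within k)) x +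
          sum_from_root (indicator (A \<inter> roots_within k)) x"
        by (rule sum_from_root_add)
      finally show ?thesis using sum_from_root_indicator_finite[of A k x] by simp
    qed
    show "sum_from_root (indicator ((UNIV - A) \<inter> roots_within k)) \<in> borel_measurable borel"
      unfolding eq[abs_def] using A base[OF open_UNIV] by measurable
  next
    fix A :: "nat \<Rightarrow> 'm birooted_net set"
    assume dis: "disjoint_family A"
      and A: "\<And>i. sum_from_root (indicator (A i \<inter> roots_within k)) \<in> borel_measurable borel"
    have eq: "sum_from_root (indicator ((\<Union>i. A i) \<inter> roots_within k)) x =
        (\<Sum>i. sum_from_root (indicator (A i \<inter> roots_within k)) x)" for x :: "'m rooted_net"
    proof -
      have "disjoint_family (\<lambda>i. A i \<inter> roots_within k)"
        using dis by (auto simp: disjoint_family_on_def)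
      then have "indicator ((\<Union>i. A i) \<inter> roots_within k) =
          (\<lambda>y. \<Sum>i. indicator (A i \<inter> roots_within k) y :: ennreal)"
        by (intro ext) (simp add: suminf_indicator flip: UN_extend_simps(4))
      then show ?thesis by (simp add: sum_from_root_suminf)
    qed
    show "sum_from_root (indicator ((\<Union>i. A i) \<inter> roots_within k)) \<in> borel_measurable borel"
      unfolding eq[abs_def] using A by measurable
  qed (use base in auto)
qed

lemma measurable_sum_from_root_indicator:
  fixes B :: "'m::metric_space birooted_net set"
  assumes "B \<in> sets borel"
  shows "sum_from_root (indicator B) \<in> borel_measurable borel"
proof -
  have inc: "roots_within i \<subseteq> (roots_within j :: 'm birooted_net set)" if "i \<le> j" for i j
  proof
    fix x :: "'m birooted_net" assume "x \<in> roots_within i"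
    then show "x \<in> roots_within j"
      using that by (cases x rule: birooted_net_cases) (simp add: class_in_roots_within_iff)
  qed
  have ex: "\<exists>k. y \<in> roots_within k" for y :: "'m birooted_net"
    by (cases y rule: birooted_net_cases) (auto simp: class_in_roots_within_iff)
  have eq: "indicator B = (\<lambda>y. SUP k. indicator (B \<inter> roots_within k) y :: ennreal)"
  proof
    fix y :: "'m birooted_net"
    obtain k where k: "y \<in> roots_within k" using ex by blast
    show "indicator B y = (SUP k. indicator (B \<inter> roots_within k) y :: ennreal)"
    proof (rule antisym)
      show "indicator B y \<le> (SUP k. indicator (B \<inter> roots_within k) y :: ennreal)"
        using k by (intro SUP_upper2[of k]) (auto simp: indicator_def)
      show "(SUP k. indicator (B \<inter> roots_within k) y :: ennreal) \<le> indicator B y"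
        by (intro SUP_least) (auto simp: indicator_def)
    qed
  qed
  have "incseq (\<lambda>k. indicator (B \<inter> roots_within k) :: _ \<Rightarrow> ennreal)"
    using inc by (fastforce simp: incseq_def le_fun_def indicator_def)
  then have "sum_from_root (indicator B) =
      (\<lambda>x. SUP k. sum_from_root (indicator (B \<inter> roots_within k)) x)"
    by (subst eq) (simp add: sum_from_root_SUP fun_eq_iff)
  then show ?thesis
    using measurable_sum_from_root_indicator_within[OF assms] by simp
qed

lemma measurable_sum_from_root:
  fixes g :: "'m::metric_space birooted_net \<Rightarrow> ennreal"
  assumes "g \<in> borel_measurable borel"
  shows "sum_from_root g \<in> borel_measurable borel"
  using assms
proof (induction rule: borel_measurable_induct)
  case (cong f g)
  then have "f = g" by auto
  then show ?case using cong by simp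
next
  case (set A)
  then show ?case by (rule measurable_sum_from_root_indicator)
next
  case (mult u c)
  have "sum_from_root (\<lambda>x. c * u x) = (\<lambda>x. c * sum_from_root u x)"
    by (simp add: fun_eq_iff sum_from_root_cmult)
  then show ?case using mult by simp
next
  case (add u v)
  have "sum_from_root (\<lambda>x. v x + u x) = (\<lambda>x. sum_from_root v x + sum_from_root u x)"
    by (simp add: fun_eq_iff sum_from_root_add)
  then show ?case using add by simp
next
  case (seq U)
  have "sum_from_root (SUP i. U i) = (\<lambda>x. SUP i. sum_from_root (U i) x)"
    using sum_from_root_SUP[OF seq(3)] by (simp add: fun_eq_iff SUP_apply[abs_def] image_comp)
  moreover have "(\<lambda>x. SUP i. sum_from_root (U i) x) \<in> borel_measurable borel"
    by (rule borel_measurable_SUP) (use seq in auto)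
  ultimately show ?case by (simp only:)
qed

lemma measurable_sum_to_root:
  fixes g :: "'m::metric_space birooted_net \<Rightarrow> ennreal"
  assumes [measurable]: "g \<in> borel_measurable borel"
  shows "sum_to_root g \<in> borel_measurable borel"
  unfolding sum_to_root_eq[abs_def] by (rule measurable_sum_from_root) measurable

section \<open>Orbits of sets of rooted networks\<close>

text \<open>
  This is the set of rooted networks that come to lie in \<open>B\<close> when the root is moved to some vertex at
  distance at most \<open>k\<close> (\<open>class_in_reaches_within_iff\<close>). The definition as a nonvanishing count makes
  measurability immediate.
\<close>

definition reaches_within :: "nat \<Rightarrow> 'm::metric_space rooted_net set \<Rightarrow> 'm rooted_net set" where
  "reaches_within k B = {x. sum_from_root (indicator (second_root -` B \<inter> roots_within k)) x \<noteq> 0}"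

lemma class_in_reaches_within_iff:
  fixes G :: "(nat, nat, 'm::metric_space) marked_graph"
  assumes G: "network G" "p \<in> verts G"
  shows "rooted_class G p \<in> reaches_within k B \<longleftrightarrow>
    (\<exists>v\<in>verts G. gdist G p v \<le> k \<and> rooted_class G v \<in> B)"
proof -
  have "finite {v \<in> verts G. birooted_class G p v \<in> second_root -` B \<inter> roots_within k}"
    by (rule finite_class_in_roots_within[OF G])
  then show ?thesis
    using G by (auto simp: reaches_within_def sum_from_root_indicator class_in_roots_within_iff
        intro: second_root_class[THEN ssubst])
qed

lemma sets_reaches_within [measurable]:
  assumes [measurable]: "B \<in> sets borel"
  shows "reaches_within k B \<in> sets borel"
proof -
  have [measurable]: "roots_within k \<in> sets borel" by (rule borel_open[OF open_roots_within])
  have "second_root -` B \<inter> roots_within k \<in> sets borel"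
    using measurable_sets[OF measurable_second_root assms] by simp
  then have [measurable]:
    "sum_from_root (indicator (second_root -` B \<inter> roots_within k)) \<in> borel_measurable borel"
    by (rule measurable_sum_from_root_indicator)
  have "{x \<in> space borel. sum_from_root (indicator (second_root -` B \<inter> roots_within k)) x \<noteq> 0}
      \<in> sets borel"
    by measurable
  then show ?thesis by (simp add: reaches_within_def)
qed

definition reaches :: "'m::metric_space rooted_net set \<Rightarrow> 'm rooted_net set" where
  "reaches B = (\<Union>k. reaches_within k B)"

lemma sets_reaches [measurable]: "B \<in> sets borel \<Longrightarrow> reaches B \<in> sets borel"
  unfolding reaches_def by (rule sets.countable_UN) (auto intro: sets_reaches_within)

lemma class_in_reaches_iff:
  fixes G :: "(nat, nat, 'm::metric_space) marked_graph"
  assumes G: "network G" "p \<in> verts G"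
  shows "rooted_class G p \<in> reaches B \<longleftrightarrow> (\<exists>v\<in>verts G. rooted_class G v \<in> B)"
  using class_in_reaches_within_iff[OF G] by (auto simp: reaches_def)

lemma subset_reaches: "B \<subseteq> reaches B"
proof
  fix x assume "x \<in> B"
  then show "x \<in> reaches B"
    by (cases x rule: rooted_net_cases) (auto simp: class_in_reaches_iff)
qed

lemma incseq_reaches_within: "incseq (\<lambda>k. reaches_within k B)"
proof (intro incseq_SucI subsetI)
  fix k x assume "x \<in> reaches_within k B"
  then show "x \<in> reaches_within (Suc k) B"
    by (cases x rule: rooted_net_cases) (auto simp: class_in_reaches_within_iff intro: le_SucI)
qed

lemma Compl_reaches_invariant:
  fixes B :: "'m::polish_space rooted_net set"
  assumes "B \<in> sets borel"
  shows "- reaches B \<in> invariant_sets"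
proof -
  have "- reaches B \<in> sets borel" using sets_reaches[OF assms] by simp
  then show ?thesis by (auto simp: invariant_sets_def class_in_reaches_iff)
qed

section \<open>Comparing two unimodular laws\<close>

text \<open>
  Unimodularity as a property of the law alone. The transported mass takes finite values in
  \<^typ>\<open>ennreal\<close>, which amounts to nonnegative real values.
\<close>

definition unimodular_law :: "'m::metric_space rooted_net measure \<Rightarrow> bool" where
  "unimodular_law P \<longleftrightarrow> sets P = sets borel \<and>
     (\<forall>g. g \<in> borel_measurable borel \<and> (\<forall>x. g x < \<top>) \<longrightarrow>
       (\<integral>\<^sup>+ x. sum_from_root g x \<partial>P) = (\<integral>\<^sup>+ x. sum_to_root g x \<partial>P))"

lemma unimodular_law_distr:
  fixes X :: "'a \<Rightarrow> 'm::polish_space rooted_net"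
  assumes X: "X \<in> M \<rightarrow>\<^sub>M borel" and uni: "unimodular M X"
  shows "unimodular_law (distr M borel X)"
  unfolding unimodular_law_def
proof (intro conjI allI impI)
  fix g :: "'m birooted_net \<Rightarrow> ennreal"
  assume g: "g \<in> borel_measurable borel \<and> (\<forall>x. g x < \<top>)"
  then have [measurable]: "g \<in> borel_measurable borel" by simp
  have eq: "(\<lambda>x. ennreal (enn2real (g x))) = g" using g by auto
  have "(\<integral>\<^sup>+ \<omega>. sum_from_root (\<lambda>x. ennreal (enn2real (g x))) (X \<omega>) \<partial>M) =
      (\<integral>\<^sup>+ \<omega>. sum_to_root (\<lambda>x. ennreal (enn2real (g x))) (X \<omega>) \<partial>M)"
    using uni[unfolded unimodular_def, rule_format, of "\<lambda>x. enn2real (g x)"] by simp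
  then show "(\<integral>\<^sup>+ x. sum_from_root g x \<partial>distr M borel X) = (\<integral>\<^sup>+ x. sum_to_root g x \<partial>distr M borel X)"
    using g by (simp add: eq nn_integral_distr[OF X] measurable_sum_from_root measurable_sum_to_root)
qed simp

lemma nn_integral_mono_off_set:
  assumes sets: "sets P = sets N" "sets Q = sets N" and A: "A \<in> sets N"
    and le: "\<And>B. B \<in> sets N \<Longrightarrow> B \<inter> A = {} \<Longrightarrow> emeasure P B \<le> emeasure Q B"
    and h: "h \<in> borel_measurable N" and zero: "\<And>x. x \<in> A \<Longrightarrow> h x = 0"
  shows "(\<integral>\<^sup>+ x. h x \<partial>P) \<le> (\<integral>\<^sup>+ x. h x \<partial>Q)"
proof -
  let ?i = "indicator (space N - A) :: _ \<Rightarrow> ennreal"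
  have sp: "space P = space N" "space Q = space N" using sets by (auto dest: sets_eq_imp_space_eq)
  have hm: "h \<in> borel_measurable P" "h \<in> borel_measurable Q"
    using h sets by (auto cong: measurable_cong_sets)
  have im: "?i \<in> borel_measurable P" "?i \<in> borel_measurable Q"
    using A sets by auto
  have hi: "?i x * h x = h x" if "x \<in> space N" for x
    using that zero by (cases "x \<in> A") auto
  have em: "emeasure (density R ?i) B = emeasure R ((space N - A) \<inter> B)"
    if "sets R = sets N" "B \<in> sets N" for R B
    using that A by (simp add: emeasure_density indicator_inter_arith[symmetric])
  have "density P ?i \<le> density Q ?i"
  proof (subst le_measure)
    show "sets (density P ?i) = sets (density Q ?i)" using sets by simp
    show "\<forall>B\<in>sets (density P ?i). emeasure (density P ?i) B \<le> emeasure (density Q ?i) B"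
      using sets A by (auto simp: em intro!: le)
  qed
  then have "(\<integral>\<^sup>+ x. h x \<partial>density P ?i) \<le> (\<integral>\<^sup>+ x. h x \<partial>density Q ?i)"
    using sets by (intro nn_integral_mono_measure) simp_all
  then have "(\<integral>\<^sup>+ x. ?i x * h x \<partial>P) \<le> (\<integral>\<^sup>+ x. ?i x * h x \<partial>Q)"
    using hm im by (simp add: nn_integral_density)
  moreover have "(\<integral>\<^sup>+ x. ?i x * h x \<partial>R) = (\<integral>\<^sup>+ x. h x \<partial>R)" if "space R = space N" for R
    using hi that by (intro nn_integral_cong) simp
  ultimately show ?thesis using sp by metis
qed

text \<open>
  Every root in \<open>C\<close> with a vertex outside \<open>A\<close> within distance \<open>k\<close> distributes mass one uniformly
  over these vertices. The left-hand side is the expected mass sent under \<open>P\<close> and, by unimodularity,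
  the expected mass received; as mass is received only outside \<open>A\<close>, it can only grow when \<open>P\<close> is
  replaced by \<open>Q\<close>.
\<close>

lemma transport_to_complement:
  fixes P Q :: "'m::polish_space rooted_net measure"
  assumes P: "unimodular_law P" and Q: "unimodular_law Q"
    and A: "A \<in> sets borel"
    and le: "\<And>B. B \<in> sets borel \<Longrightarrow> B \<inter> A = {} \<Longrightarrow> emeasure P B \<le> emeasure Q B"
    and C: "C \<in> sets borel" "C \<subseteq> A"
  shows "emeasure P (C \<inter> reaches_within k (- A)) \<le> emeasure Q (C \<inter> reaches_within k (- A))"
proof -
  have sets: "sets P = sets borel" "sets Q = sets borel"
    using P Q by (auto simp: unimodular_law_def)
  define S where "S = second_root -` (- A) \<inter> (roots_within k :: 'm birooted_net set)"
  define \<phi> where "\<phi> = (sum_from_root (indicator S) :: 'm rooted_net \<Rightarrow> ennreal)"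
  define g where "g y = indicator C (first_root y) * inverse (\<phi> (first_root y)) * (indicator S y :: ennreal)" for y
  have "- A \<in> sets borel" using A by simp
  then have D: "C \<inter> reaches_within k (- A) \<in> sets borel" using C by measurable
  have S [measurable]: "S \<in> sets borel"
    using measurable_sets[OF measurable_second_root \<open>- A \<in> sets borel\<close>]
    unfolding S_def by (auto intro: borel_open open_roots_within)
  have [measurable]: "\<phi> \<in> borel_measurable borel"
    unfolding \<phi>_def by (rule measurable_sum_from_root_indicator[OF S])
  note C(1)[measurable]
  have g: "g \<in> borel_measurable borel" unfolding g_def by measurable
  have \<phi>_fin: "\<phi> x < \<top>" for x unfolding \<phi>_def S_def by (rule sum_from_root_indicator_finite)
  \<comment> \<open>A root that sends mass has at least one recipient, so the share \<open>inverse (\<phi> _)\<close> is finite.\<close>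
  have \<phi>_pos: "\<phi> (first_root y) \<noteq> 0" if "y \<in> S" for y
  proof (cases y rule: birooted_net_cases)
    case (1 G p v)
    then have "gdist G p v \<le> k" "rooted_class G v \<in> - A"
      using that by (auto simp: S_def class_in_roots_within_iff)
    then have "rooted_class G p \<in> reaches_within k (- A)"
      using 1 by (auto simp: class_in_reaches_within_iff)
    then show ?thesis using 1 by (simp add: reaches_within_def \<phi>_def S_def)
  qed
  have g_fin: "g y < \<top>" for y
    using \<phi>_pos[of y] by (auto simp: g_def indicator_def ennreal_inverse_eq_top_iff less_top[symmetric])
  \<comment> \<open>The shares add up to one, unless there is no recipient and the sum is empty.\<close>
  have sent: "sum_from_root g x = indicator (C \<inter> reaches_within k (- A)) x" for x
  proof (cases x rule: rooted_net_cases)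
    case (1 G p)
    have "sum_from_root g x =
        sum_from_root (\<lambda>y. indicator C x * inverse (\<phi> x) * indicator S y) x"
      using 1 by (auto simp: sum_from_root_class g_def intro!: nn_integral_cong)
    also have "\<dots> = indicator C x * (inverse (\<phi> x) * \<phi> x)"
      by (simp add: sum_from_root_cmult \<phi>_def mult.assoc)
    also have "\<dots> = indicator (C \<inter> reaches_within k (- A)) x"
      using \<phi>_fin[of x] ennreal_divide_self[of "\<phi> x"]
      by (auto simp: indicator_def reaches_within_def \<phi>_def S_def divide_ennreal_def mult.commute)
    finally show ?thesis .
  qed
  have received: "sum_to_root g x = 0" if "x \<in> A" for x
  proof (cases x rule: rooted_net_cases)
    case (1 G p)
    have "sum_to_root g x = (\<integral>\<^sup>+ v. 0 \<partial>count_space (verts G))"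
      unfolding sum_to_root_eq 1(3) sum_from_root_class[OF 1(1,2)]
      using 1 that by (intro nn_integral_cong) (auto simp: g_def S_def)
    then show ?thesis by simp
  qed
  have eq: "emeasure R (C \<inter> reaches_within k (- A)) = (\<integral>\<^sup>+ x. sum_to_root g x \<partial>R)"
    if R: "unimodular_law R" for R
  proof -
    have "sets R = sets borel" using R by (simp add: unimodular_law_def)
    then have "emeasure R (C \<inter> reaches_within k (- A)) = (\<integral>\<^sup>+ x. sum_from_root g x \<partial>R)"
      unfolding sent using D by (simp add: nn_integral_indicator)
    then show ?thesis using R g g_fin by (simp add: unimodular_law_def)
  qed
  have "(\<integral>\<^sup>+ x. sum_to_root g x \<partial>P) \<le> (\<integral>\<^sup>+ x. sum_to_root g x \<partial>Q)"
    by (rule nn_integral_mono_off_set[OF sets A le measurable_sum_to_root[OF g] received])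
  then show ?thesis by (simp only: eq[OF P] eq[OF Q])
qed

lemma transport_to_reachable_complement:
  fixes P Q :: "'m::polish_space rooted_net measure"
  assumes P: "unimodular_law P" and Q: "unimodular_law Q"
    and A: "A \<in> sets borel"
    and le: "\<And>B. B \<in> sets borel \<Longrightarrow> B \<inter> A = {} \<Longrightarrow> emeasure P B \<le> emeasure Q B"
    and C: "C \<in> sets borel" "C \<subseteq> A"
  shows "emeasure P (C \<inter> reaches (- A)) \<le> emeasure Q (C \<inter> reaches (- A))"
proof -
  have "- A \<in> sets borel" using A by simp
  then have D: "C \<inter> reaches_within k (- A) \<in> sets borel" for k using C by measurable
  have "emeasure R (C \<inter> reaches (- A)) = (SUP k. emeasure R (C \<inter> reaches_within k (- A)))"
    if "unimodular_law R" for R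
  proof -
    have "incseq (\<lambda>k. C \<inter> reaches_within k (- A))"
      using incseq_reaches_within[of "- A"] by (auto simp: incseq_def)
    then have "(SUP k. emeasure R (C \<inter> reaches_within k (- A))) =
        emeasure R (\<Union>k. C \<inter> reaches_within k (- A))"
      using that D by (intro SUP_emeasure_incseq) (auto simp: unimodular_law_def)
    then show ?thesis by (simp add: reaches_def)
  qed
  then show ?thesis
    using P Q by (auto intro!: SUP_mono' transport_to_complement[OF P Q A le C])
qed

text \<open>
  Roots that see the complement of \<open>A\<close> are handled by mass transport. The other roots lie in the
  invariant set \<open>- reaches (- A)\<close>, which is contained in \<open>A\<close> and has the same finite mass under \<open>P\<close> and
  \<open>Q\<close>; since \<open>Q \<le> P\<close> on all parts of it, the two measures coincide on these parts.
\<close>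

lemma emeasure_eq_on_Hahn_set:
  fixes P Q :: "'m::polish_space rooted_net measure"
  assumes fin: "finite_measure P" "finite_measure Q"
    and P: "unimodular_law P" and Q: "unimodular_law Q"
    and inv: "\<And>A. A \<in> invariant_sets \<Longrightarrow> emeasure P A = emeasure Q A"
    and A: "A \<in> sets borel"
    and ge: "\<And>B. B \<in> sets borel \<Longrightarrow> B \<subseteq> A \<Longrightarrow> emeasure Q B \<le> emeasure P B"
    and le: "\<And>B. B \<in> sets borel \<Longrightarrow> B \<inter> A = {} \<Longrightarrow> emeasure P B \<le> emeasure Q B"
    and C: "C \<in> sets borel" "C \<subseteq> A"
  shows "emeasure P C = emeasure Q C"
proof -
  have sets: "sets P = sets borel" "sets Q = sets borel"
    using P Q by (auto simp: unimodular_law_def)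
  have cA: "- A \<in> sets borel" using A by simp
  let ?O = "reaches (- A)" and ?I = "- reaches (- A)"
  have O: "?O \<in> sets borel" "?I \<in> sets borel" using sets_reaches[OF cA] by auto
  have IA: "?I \<subseteq> A" using subset_reaches[of "- A"] by auto
  have 1: "emeasure P (C \<inter> ?O) = emeasure Q (C \<inter> ?O)"
  proof (rule antisym)
    show "emeasure P (C \<inter> ?O) \<le> emeasure Q (C \<inter> ?O)"
      by (rule transport_to_reachable_complement[OF P Q A le C])
    show "emeasure Q (C \<inter> ?O) \<le> emeasure P (C \<inter> ?O)" using C O by (intro ge) auto
  qed
  have 2: "emeasure P (C \<inter> ?I) = emeasure Q (C \<inter> ?I)"
  proof (rule antisym)
    show "emeasure Q (C \<inter> ?I) \<le> emeasure P (C \<inter> ?I)" using C O by (intro ge) auto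
    have split: "emeasure R ?I = emeasure R (C \<inter> ?I) + emeasure R (?I - C)"
      if "sets R = sets borel" for R
      using C O that by (subst plus_emeasure) (auto intro!: arg_cong[where f = "emeasure R"])
    have "emeasure P (C \<inter> ?I) + emeasure P (?I - C) = emeasure Q (C \<inter> ?I) + emeasure Q (?I - C)"
      using inv[OF Compl_reaches_invariant[OF cA]] split sets by metis
    also have "\<dots> \<le> emeasure Q (C \<inter> ?I) + emeasure P (?I - C)"
      using C O IA by (intro add_left_mono ge) auto
    finally show "emeasure P (C \<inter> ?I) \<le> emeasure Q (C \<inter> ?I)"
      using finite_measure.emeasure_finite[OF fin(1), of "?I - C"]
      by (simp add: ennreal_add_left_cancel_le add.commute[of _ "emeasure P (?I - C)"])
  qed
  have split: "emeasure R C = emeasure R (C \<inter> ?O) + emeasure R (C \<inter> ?I)"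
    if "sets R = sets borel" for R
    using C O that by (subst plus_emeasure) (auto intro!: arg_cong[where f = "emeasure R"])
  show ?thesis using 1 2 split sets by metis
qed

lemma unimodular_law_eqI:
  fixes P Q :: "'m::polish_space rooted_net measure"
  assumes fin: "finite_measure P" "finite_measure Q"
    and P: "unimodular_law P" and Q: "unimodular_law Q"
    and inv: "\<And>A. A \<in> invariant_sets \<Longrightarrow> emeasure P A = emeasure Q A"
  shows "P = Q"
proof (rule measure_eqI)
  have sets: "sets P = sets borel" "sets Q = sets borel"
    using P Q by (auto simp: unimodular_law_def)
  then show "sets P = sets Q" by simp
  obtain A where A: "A \<in> sets borel"
    and ge: "\<And>B. B \<in> sets borel \<Longrightarrow> B \<subseteq> A \<Longrightarrow> emeasure Q B \<le> emeasure P B"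
    and le: "\<And>B. B \<in> sets borel \<Longrightarrow> B \<inter> A = {} \<Longrightarrow> emeasure P B \<le> emeasure Q B"
    using finite_unsigned_Hahn_decomposition[OF fin] sets by auto
  fix B assume "B \<in> sets P"
  then have B: "B \<in> sets borel" using sets by simp
  have "emeasure P (B \<inter> A) = emeasure Q (B \<inter> A)"
    using A B by (intro emeasure_eq_on_Hahn_set[OF fin P Q inv A ge le]) auto
  \<comment> \<open>\<open>- A\<close> plays the role of \<open>A\<close> once \<open>P\<close> and \<open>Q\<close> are exchanged.\<close>
  moreover have "emeasure Q (B - A) = emeasure P (B - A)"
  proof (rule emeasure_eq_on_Hahn_set[OF fin(2,1) Q P])
    show "- A \<in> sets borel" "B - A \<in> sets borel" using A B by auto
    show "emeasure P X \<le> emeasure Q X" if "X \<in> sets borel" "X \<subseteq> - A" for X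
      using that by (intro le) auto
    show "emeasure Q X \<le> emeasure P X" if "X \<in> sets borel" "X \<inter> - A = {}" for X
      using that by (intro ge) auto
  qed (use inv in auto)
  moreover have "emeasure R B = emeasure R (B \<inter> A) + emeasure R (B - A)"
    if "sets R = sets borel" for R
    using A B that by (subst plus_emeasure) (auto intro!: arg_cong[where f = "emeasure R"])
  ultimately show "emeasure P B = emeasure Q B" using sets by metis
qed

section \<open>Invariant sets and unrooted networks\<close>

lemma unroot_class: "network G \<Longrightarrow> p \<in> verts G \<Longrightarrow> unroot (rooted_class G p) = net_class G"
  by (simp add: unroot.abs_eq rooted_iso_refl)

text \<open>
  Two rooted networks with the same underlying network are two rootings of one representative: the
  isomorphism moves the root of the first representative into the second one.
\<close>

lemma unroot_eqE:
  assumes "unroot x = unroot y"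
  obtains G p q where "network G" "p \<in> verts G" "q \<in> verts G"
    "x = rooted_class G p" "y = rooted_class G q"
proof -
  obtain K k where K: "network K" "k \<in> verts K" "x = rooted_class K k" by (rule rooted_net_cases)
  obtain G q where G: "network G" "q \<in> verts G" "y = rooted_class G q" by (rule rooted_net_cases)
  have refl: "unrooted_iso L L" if "network L" for L :: "(nat, nat, 'a) marked_graph"
    using that network_iso_id by (auto simp: unrooted_iso_def)
  have "net_class K = net_class G" using assms K G by (simp add: unroot_class)
  then have "unrooted_iso K G"
    using Quotient3_rel[OF Quotient3_unrooted_net, of K G] refl K(1) G(1) by blast
  then obtain f g where f: "network_iso f g K G" by (auto simp: unrooted_iso_def)
  then have fk: "f k \<in> verts G" using K by (auto simp: network_iso_def graph_iso_def bij_betw_def)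
  have "x = rooted_class G (f k)"
    unfolding K(3) using rooted_class_eq_iff[OF K(1,2) G(1) fk] f by blast
  then show thesis using that[OF G(1) fk G(2)] G(3) by blast
qed

text \<open>
  An invariant set contains, with a rooted network, all rootings of the same network, and therefore
  it is the preimage of its own image under \<open>unroot\<close>.
\<close>

lemma invariant_sets_eq: "invariant_sets = (\<lambda>B. unroot -` B) ` sets unrooted_algebra"
proof (intro equalityI subsetI)
  fix A :: "'a rooted_net set" assume A: "A \<in> invariant_sets"
  have "unroot -` unroot ` A \<subseteq> A"
  proof
    fix y assume "y \<in> unroot -` unroot ` A"
    then obtain x where x: "x \<in> A" "unroot x = unroot y" by auto
    from x(2) show "y \<in> A"
      by (rule unroot_eqE) (use A x(1) in \<open>auto simp: invariant_sets_def\<close>)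
  qed
  then have "unroot -` unroot ` A = A" by auto
  moreover from this have "unroot ` A \<in> sets unrooted_algebra"
    using A by (simp add: sets_unrooted_algebra invariant_sets_def)
  ultimately show "A \<in> (\<lambda>B. unroot -` B) ` sets unrooted_algebra" by (metis imageI)
next
  fix A :: "'a rooted_net set" assume "A \<in> (\<lambda>B. unroot -` B) ` sets unrooted_algebra"
  then show "A \<in> invariant_sets"
    by (auto simp: invariant_sets_def sets_unrooted_algebra unroot_class)
qed

lemma strongly_unrooted_equiv_iff_emeasure:
  fixes X\<^sub>1 :: "'a \<Rightarrow> 'm::polish_space rooted_net" and X\<^sub>2 :: "'b \<Rightarrow> 'm rooted_net"
  assumes "unimodular_network M\<^sub>1 X\<^sub>1" and "unimodular_network M\<^sub>2 X\<^sub>2"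
  shows "strongly_unrooted_equiv M\<^sub>1 X\<^sub>1 M\<^sub>2 X\<^sub>2 \<longleftrightarrow>
    (\<forall>A\<in>invariant_sets. emeasure (distr M\<^sub>1 borel X\<^sub>1) A = emeasure (distr M\<^sub>2 borel X\<^sub>2) A)"
proof -
  interpret M1: prob_space M\<^sub>1 using assms by (simp add: unimodular_network_def)
  interpret M2: prob_space M\<^sub>2 using assms by (simp add: unimodular_network_def)
  have X: "X\<^sub>1 \<in> M\<^sub>1 \<rightarrow>\<^sub>M borel" "X\<^sub>2 \<in> M\<^sub>2 \<rightarrow>\<^sub>M borel"
    using assms by (simp_all add: unimodular_network_def)
  have "A \<in> sets borel" if "A \<in> invariant_sets" for A :: "'m rooted_net set"
    using that by (simp add: invariant_sets_def)
  then show ?thesis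
    unfolding strongly_unrooted_equiv_def
    by (auto simp: emeasure_distr[OF X(1)] emeasure_distr[OF X(2)]
        M1.emeasure_eq_measure M2.emeasure_eq_measure intro!: ball_cong)
qed

lemma strongly_unrooted_equiv_iff_unrooted_law:
  fixes X\<^sub>1 :: "'a \<Rightarrow> 'm::polish_space rooted_net" and X\<^sub>2 :: "'b \<Rightarrow> 'm rooted_net"
  assumes "unimodular_network M\<^sub>1 X\<^sub>1" and "unimodular_network M\<^sub>2 X\<^sub>2"
  shows "strongly_unrooted_equiv M\<^sub>1 X\<^sub>1 M\<^sub>2 X\<^sub>2 \<longleftrightarrow>
    distr M\<^sub>1 unrooted_algebra (\<lambda>\<omega>. unroot (X\<^sub>1 \<omega>)) =
    distr M\<^sub>2 unrooted_algebra (\<lambda>\<omega>. unroot (X\<^sub>2 \<omega>))"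
proof -
  have law: "distr M unrooted_algebra (\<lambda>\<omega>. unroot (X \<omega>)) = distr (distr M borel X) unrooted_algebra unroot"
    if "unimodular_network M X" for M :: "'z measure" and X :: "'z \<Rightarrow> 'm rooted_net"
    using that by (subst distr_distr) (auto simp: unimodular_network_def comp_def)
  have "(\<forall>A\<in>invariant_sets. emeasure P A = emeasure Q A) \<longleftrightarrow>
      distr P unrooted_algebra unroot = distr Q unrooted_algebra unroot"
    if "sets P = sets borel" "sets Q = sets borel" for P Q :: "'m rooted_net measure"
  proof -
    have "unroot \<in> P \<rightarrow>\<^sub>M unrooted_algebra" "unroot \<in> Q \<rightarrow>\<^sub>M unrooted_algebra" "space P = UNIV" "space Q = UNIV"
      using that measurable_unroot by (auto cong: measurable_cong_sets dest: sets_eq_imp_space_eq)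
    then have em: "emeasure (distr P unrooted_algebra unroot) B = emeasure P (unroot -` B)"
      "emeasure (distr Q unrooted_algebra unroot) B = emeasure Q (unroot -` B)"
      if "B \<in> sets unrooted_algebra" for B
      using that by (simp_all add: emeasure_distr)
    show ?thesis
      unfolding invariant_sets_eq using em by (auto intro!: measure_eqI)
  qed
  then show ?thesis
    unfolding strongly_unrooted_equiv_iff_emeasure[OF assms] law[OF assms(1)] law[OF assms(2)] by simp
qed

theorem theorem3:
  fixes M\<^sub>1 :: "'a measure" and X\<^sub>1 :: "'a \<Rightarrow> 'm::polish_space rooted_net"
    and M\<^sub>2 :: "'b measure" and X\<^sub>2 :: "'b \<Rightarrow> 'm rooted_net"
  assumes "unimodular_network M\<^sub>1 X\<^sub>1" and "unimodular_network M\<^sub>2 X\<^sub>2"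
  shows "(strongly_unrooted_equiv M\<^sub>1 X\<^sub>1 M\<^sub>2 X\<^sub>2 \<longleftrightarrow>
            distr M\<^sub>1 unrooted_algebra (\<lambda>\<omega>. unroot (X\<^sub>1 \<omega>)) =
            distr M\<^sub>2 unrooted_algebra (\<lambda>\<omega>. unroot (X\<^sub>2 \<omega>))) \<and>
         (strongly_unrooted_equiv M\<^sub>1 X\<^sub>1 M\<^sub>2 X\<^sub>2 \<longrightarrow> distr M\<^sub>1 borel X\<^sub>1 = distr M\<^sub>2 borel X\<^sub>2)"
proof (intro conjI impI)
  show "strongly_unrooted_equiv M\<^sub>1 X\<^sub>1 M\<^sub>2 X\<^sub>2 \<longleftrightarrow>
      distr M\<^sub>1 unrooted_algebra (\<lambda>\<omega>. unroot (X\<^sub>1 \<omega>)) =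
      distr M\<^sub>2 unrooted_algebra (\<lambda>\<omega>. unroot (X\<^sub>2 \<omega>))"
    by (rule strongly_unrooted_equiv_iff_unrooted_law[OF assms])
  assume eq: "strongly_unrooted_equiv M\<^sub>1 X\<^sub>1 M\<^sub>2 X\<^sub>2"
  have law: "finite_measure (distr M borel X) \<and> unimodular_law (distr M borel X)"
    if "unimodular_network M X" for M :: "'z measure" and X :: "'z \<Rightarrow> 'm rooted_net"
    using that by (auto simp: unimodular_network_def prob_space.finite_measure prob_space.prob_space_distr
        intro: unimodular_law_distr)
  show "distr M\<^sub>1 borel X\<^sub>1 = distr M\<^sub>2 borel X\<^sub>2"
  proof (rule unimodular_law_eqI)
    show "emeasure (distr M\<^sub>1 borel X\<^sub>1) A = emeasure (distr M\<^sub>2 borel X\<^sub>2) A"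
      if "A \<in> invariant_sets" for A
      using eq that by (simp add: strongly_unrooted_equiv_iff_emeasure[OF assms])
  qed (use law[OF assms(1)] law[OF assms(2)] in simp_all)
qed

end
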